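(* Let $\Omega\subset\mathbb{R}^N$ be a bounded regular domain, $\lambda_0:\Omega\to(0,\infty)$ a function bounded away from zero and from infinity, and $g:\partial\Omega\to\mathbb{R}$ a Lipschitz function. Let $u_\infty$ be a uniform limit (along some sequence $p\to\infty$) of weak solutions $u_p$ to $$-\Delta_p u_p+\lambda_0(x)\chi_{\{u_p>0\}}(x)=0\ \text{ in }\Omega,\qquad u_p=g\ \text{ on }\partial\Omega,$$ and let $\Omega'\Subset\Omega$. Then there is $r_0>0$ such that for any $x_0\in\partial\{u_\infty>0\}\cap\Omega'$ and any $0<r<r_0$, $$\sup_{B_r(x_0)}u_\infty(x)\ge r.$$
   Context: $\Delta_p u=\operatorname{div}(|\nabla u|^{p-2}\nabla u)$; $\chi_A$ is the characteristic function of $A$. "Regular domain" means a domain with smooth boundary. A weak solution $u_p\in W^{1,p}(\Omega)$ satisfies $\int_\Omega|\nabla u_p|^{p-2}\nabla u_p\cdot\nabla\varphi\,dx=-\int_\Omega\lambda_0\chi_{\{u_p>0\}}\varphi\,dx$ for all $\varphi\in C^1_0(\Omega)$ and takes the boundary value $g$. *)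

theory Defs
  imports "HOL-Analysis.Analysis"
begin

text \<open>All integrals are Lebesgue integrals over \<open>lebesgue_on \<Omega>\<close>.\<close>

definition grad :: "('a::euclidean_space \<Rightarrow> real) \<Rightarrow> 'a \<Rightarrow> 'a" where
  "grad f x = (\<Sum>b\<in>Basis. frechet_derivative f (at x) b *\<^sub>R b)"

lemma grad_eq: "GDERIV f x :> D \<Longrightarrow> grad f x = D"
proof -
  assume "GDERIV f x :> D"
  then have "(f has_derivative (\<lambda>h. h \<bullet> D)) (at x)"
    by (simp add: gderiv_def)
  then have "frechet_derivative f (at x) = (\<lambda>h. h \<bullet> D)"
    by (rule frechet_derivative_at [symmetric])
  then show "grad f x = D"
    by (simp add: grad_def inner_commute[of _ D] euclidean_representation)
qed

text \<open>\<open>C_on k S f\<close>: \<open>f\<close> is of class $C^k$ on the open set \<open>S\<close>, i.e. all iterated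
  directional derivatives of order at most \<open>k\<close> exist (as total derivatives) and are continuous.\<close>

fun C_on :: "nat \<Rightarrow> 'a::euclidean_space set \<Rightarrow> ('a \<Rightarrow> real) \<Rightarrow> bool" where
  "C_on 0 S f \<longleftrightarrow> continuous_on S f"
| "C_on (Suc k) S f \<longleftrightarrow> (\<forall>x\<in>S. f differentiable (at x)) \<and>
     (\<forall>v. C_on k S (\<lambda>x. frechet_derivative f (at x) v))"

text \<open>Near each boundary point, \<open>\<Omega>\<close> is the set where a $C^\infty$ function with nonvanishing
  gradient is negative; in particular \<open>\<Omega>\<close> lies locally on one side of its boundary.\<close>

definition smooth_boundary :: "'a::euclidean_space set \<Rightarrow> bool" where
  "smooth_boundary \<Omega> \<longleftrightarrow> (\<forall>x\<in>frontier \<Omega>. \<exists>U \<rho>. open U \<and> x \<in> U \<and>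
     (\<forall>k. C_on k U \<rho>) \<and> (\<forall>y\<in>U. grad \<rho> y \<noteq> 0) \<and>
     \<Omega> \<inter> U = {y\<in>U. \<rho> y < 0} \<and> frontier \<Omega> \<inter> U = {y\<in>U. \<rho> y = 0})"

definition bounded_regular_domain :: "'a::euclidean_space set \<Rightarrow> bool" where
  "bounded_regular_domain \<Omega> \<longleftrightarrow>
     open \<Omega> \<and> connected \<Omega> \<and> \<Omega> \<noteq> {} \<and> bounded \<Omega> \<and> smooth_boundary \<Omega>"

text \<open>$C^1_0(\Omega)$: compactly supported $C^1$ functions, extended by zero.\<close>

definition C1_0 :: "'a::euclidean_space set \<Rightarrow> ('a \<Rightarrow> real) set" where
  "C1_0 \<Omega> = {\<phi>. C_on 1 UNIV \<phi> \<and> (\<exists>K. compact K \<and> K \<subseteq> \<Omega> \<and> (\<forall>x. x \<notin> K \<longrightarrow> \<phi> x = 0))}"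

definition Lp_on :: "real \<Rightarrow> 'a::euclidean_space set \<Rightarrow> ('a \<Rightarrow> 'b::euclidean_space) \<Rightarrow> bool" where
  "Lp_on p \<Omega> f \<longleftrightarrow> f \<in> borel_measurable (lebesgue_on \<Omega>) \<and>
     integrable (lebesgue_on \<Omega>) (\<lambda>x. norm (f x) powr p)"

definition weak_gradient :: "'a::euclidean_space set \<Rightarrow> ('a \<Rightarrow> real) \<Rightarrow> ('a \<Rightarrow> 'a) \<Rightarrow> bool" where
  "weak_gradient \<Omega> u Du \<longleftrightarrow> (\<forall>\<phi>\<in>C1_0 \<Omega>.
     (LINT x|lebesgue_on \<Omega>. u x *\<^sub>R grad \<phi> x) = - (LINT x|lebesgue_on \<Omega>. \<phi> x *\<^sub>R Du x))"

text \<open>\<open>sobolev1 p \<Omega> u Du\<close>: \<open>u\<close> lies in $W^{1,p}(\Omega)$ and \<open>Du\<close> is (a representative of) its weak gradient.\<close>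

definition sobolev1 :: "real \<Rightarrow> 'a::euclidean_space set \<Rightarrow> ('a \<Rightarrow> real) \<Rightarrow> ('a \<Rightarrow> 'a) \<Rightarrow> bool" where
  "sobolev1 p \<Omega> u Du \<longleftrightarrow> Lp_on p \<Omega> u \<and> Lp_on p \<Omega> Du \<and> weak_gradient \<Omega> u Du"

text \<open>$W^{1,p}_0(\Omega)$: the closure of $C^1_0(\Omega)$ in $W^{1,p}(\Omega)$.\<close>

definition sobolev1_0 :: "real \<Rightarrow> 'a::euclidean_space set \<Rightarrow> ('a \<Rightarrow> real) set" where
  "sobolev1_0 p \<Omega> = {w. \<exists>Dw. sobolev1 p \<Omega> w Dw \<and>
     (\<exists>\<phi>. (\<forall>j::nat. \<phi> j \<in> C1_0 \<Omega>) \<and>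
       (\<lambda>j. LINT x|lebesgue_on \<Omega>. \<bar>\<phi> j x - w x\<bar> powr p) \<longlonglongrightarrow> 0 \<and>
       (\<lambda>j. LINT x|lebesgue_on \<Omega>. norm (grad (\<phi> j) x - Dw x) powr p) \<longlonglongrightarrow> 0)}"

text \<open>\<open>u = g\<close> on the boundary in the Sobolev sense, for Lipschitz \<open>g\<close> (only its values
  on \<open>frontier \<Omega>\<close> matter): \<open>u - G\<close> lies in $W^{1,p}_0(\Omega)$ for a Lipschitz extension \<open>G\<close> of \<open>g\<close>.\<close>

definition has_boundary_value ::
  "real \<Rightarrow> 'a::euclidean_space set \<Rightarrow> ('a \<Rightarrow> real) \<Rightarrow> ('a \<Rightarrow> real) \<Rightarrow> bool" where
  "has_boundary_value p \<Omega> g u \<longleftrightarrow> (\<exists>G L. L-lipschitz_on (closure \<Omega>) G \<and>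
     (\<forall>x\<in>frontier \<Omega>. G x = g x) \<and> (\<lambda>x. u x - G x) \<in> sobolev1_0 p \<Omega>)"

text \<open>Weak solutions of $-\Delta_p u + \lambda_0 \chi_{\{u>0\}} = 0$ in \<open>\<Omega>\<close>, \<open>u = g\<close> on the boundary.
  Where \<open>Du x = 0\<close> the vector \<open>(norm (Du x) powr (p - 2)) *\<^sub>R Du x\<close> is \<open>0\<close>, also for \<open>1 < p < 2\<close>.\<close>

definition weak_solution :: "real \<Rightarrow> 'a::euclidean_space set \<Rightarrow> ('a \<Rightarrow> real) \<Rightarrow>
    ('a \<Rightarrow> real) \<Rightarrow> ('a \<Rightarrow> real) \<Rightarrow> bool" where
  "weak_solution p \<Omega> lam0 g u \<longleftrightarrow>
     (\<exists>Du. sobolev1 p \<Omega> u Du \<and>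
        (\<forall>\<phi>\<in>C1_0 \<Omega>.
          (LINT x|lebesgue_on \<Omega>. ((norm (Du x) powr (p - 2)) *\<^sub>R Du x) \<bullet> grad \<phi> x) =
          - (LINT x|lebesgue_on \<Omega>. lam0 x * indicator {y. u y > 0} x * \<phi> x))) \<and>
     has_boundary_value p \<Omega> g u"

end

theory Submission
  imports Defs
begin

text \<open>
  Let \<open>u p\<close> be positive at a point \<open>y\<close> close to the free boundary. The radial function
  \<open>v x = c * norm (x - y) powr (p / (p - 1))\<close> with \<open>(c * p / (p - 1)) powr (p - 1) = m / (2 * N)\<close>
  has \<open>p\<close>-Laplacian \<open>m / 2\<close>, where \<open>m\<close> bounds \<open>lam0\<close> from below. If \<open>u p < v\<close> held on the sphere of
  radius \<open>R\<close> about \<open>y\<close>, then the square of the positive part of \<open>u p - v - \<delta>\<close> would be a test function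
  supported in the ball, on whose support \<open>u p > 0\<close>; monotonicity of the \<open>p\<close>-Laplacian then
  contradicts \<open>m / 2 < lam0\<close>. Hence \<open>u p\<close> reaches \<open>c * R powr (p / (p - 1))\<close> on the sphere, a quantity that
  tends to \<open>R\<close> as \<open>p\<close> tends to infinity. Since only \<open>C\<^sup>1\<close> test functions are admissible, \<open>u p\<close> is
  mollified first, and its gradient converges in \<open>L\<^sup>p\<close> on the ball.
\<close>

subsection \<open>Mollifiers\<close>

text \<open>The gradient of the test function contains the mollified gradient of \<open>u p\<close>,
  while the flux in the equation contains the gradient of \<open>u p\<close> itself. Monotonicity
  therefore holds only up to an error: the flux difference paired with the difference of the two
  gradients. The flux lies in the dual exponent \<open>p / (p - 1)\<close>, so smallness of the
  gradient difference in the p-norm makes this error small. It must be beaten by a quantity that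
  does not depend on the mollification scale. That quantity is \<open>m / 2\<close> times the
  integral of the test function, which stays bounded below because \<open>u p\<close> is positive
  near \<open>y\<close> while the barrier vanishes at \<open>y\<close>; this is why the barrier uses
  only half of \<open>m\<close>. Continuity of \<open>u p\<close> makes the mollification a uniform
  approximation on the ball, which keeps the test function zero near the sphere and keeps
  \<open>u p\<close> positive on its support. The factor \<open>N\<close> in the constant is the
  divergence of \<open>x - y\<close>.\<close>

definition sqpos :: "real \<Rightarrow> real" where
  "sqpos t = (max 0 t)\<^sup>2"

lemma sqpos_nonneg [simp]: "0 \<le> sqpos t"
  by (simp add: sqpos_def)

lemma sqpos_eq_0 [simp]: "t \<le> 0 \<Longrightarrow> sqpos t = 0"
  by (simp add: sqpos_def)

text \<open>The derivative \<open>2 * max 0 t\<close> is Lipschitz with constant 2, hence a bound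
  uniform in \<open>t\<close>. Squaring makes the positive part C^1, as test functions must be; the
  same function yields both the smoothing kernel and the comparison function.\<close>

lemma sqpos_remainder:
  "\<bar>sqpos (t + s) - sqpos t - 2 * max 0 t * s\<bar> \<le> s\<^sup>2"
proof -
  have "(t + s)\<^sup>2 - t\<^sup>2 - 2 * t * s = s\<^sup>2"
    by (simp add: power2_eq_square algebra_simps)
  moreover have "t\<^sup>2 + 2 * t * s \<le> 0" "- (t\<^sup>2 + 2 * t * s) \<le> s\<^sup>2" if "t > 0" "t + s \<le> 0"
  proof -
    have "t * (t + 2 * s) \<le> 0"
      using that by (intro mult_nonneg_nonpos) auto
    then show "t\<^sup>2 + 2 * t * s \<le> 0"
      by (simp add: power2_eq_square algebra_simps)
    have "0 \<le> (t + s)\<^sup>2" by simp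
    then show "- (t\<^sup>2 + 2 * t * s) \<le> s\<^sup>2"
      by (simp add: power2_eq_square algebra_simps)
  qed
  moreover have "(t + s)\<^sup>2 \<le> s\<^sup>2" if "t \<le> 0" "t + s > 0"
    using that by (intro power_mono) auto
  ultimately show ?thesis
    by (cases "t > 0"; cases "t + s > 0") (auto simp: sqpos_def max_def not_less abs_le_iff)
qed

lemma sqpos_has_real_derivative: "(sqpos has_real_derivative 2 * max 0 t) (at t)"
proof -
  have "((\<lambda>s. (sqpos (t + s) - sqpos t) / s) \<longlongrightarrow> 2 * max 0 t) (at 0)"
  proof (rule Lim_transform_bound[of "\<lambda>s. (sqpos (t + s) - sqpos t) / s - 2 * max 0 t" "\<lambda>s. s", THEN Lim_null[THEN iffD2]])
    show "\<forall>\<^sub>F s in at 0. norm ((sqpos (t + s) - sqpos t) / s - 2 * max 0 t) \<le> norm s"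
      unfolding eventually_at_filter
    proof (intro always_eventually allI impI)
      fix s :: real assume "s \<noteq> 0"
      then have "(sqpos (t + s) - sqpos t) / s - 2 * max 0 t = (sqpos (t + s) - sqpos t - 2 * max 0 t * s) / s"
        by (simp add: field_simps)
      also have "norm \<dots> \<le> s\<^sup>2 / \<bar>s\<bar>"
        using sqpos_remainder[of t s] by (simp add: divide_right_mono)
      also have "\<dots> = norm s" using \<open>s \<noteq> 0\<close> by (cases "s > 0") (auto simp: power2_eq_square)
      finally show "norm ((sqpos (t + s) - sqpos t) / s - 2 * max 0 t) \<le> norm s" .
    qed
  qed auto
  then show ?thesis by (simp add: DERIV_def)
qed

lemma continuous_on_sqpos [continuous_intros]:
  "continuous_on S f \<Longrightarrow> continuous_on S (\<lambda>x. sqpos (f x))"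
  unfolding sqpos_def by (intro continuous_intros)

text \<open>A piecewise polynomial kernel supported in \<open>cball 0 e\<close>, in place of the
  usual exponential one. It is C^1, which is what \<open>C1_0\<close> asks for, and its Taylor
  remainder is explicit.\<close>

definition bump :: "real \<Rightarrow> 'a::euclidean_space \<Rightarrow> real" where
  "bump e x = sqpos (e\<^sup>2 - x \<bullet> x)"

definition bump_grad :: "real \<Rightarrow> 'a::euclidean_space \<Rightarrow> 'a" where
  "bump_grad e x = (- 4 * max 0 (e\<^sup>2 - x \<bullet> x)) *\<^sub>R x"

lemma bump_nonneg [simp]: "0 \<le> bump e x"
  by (simp add: bump_def)

lemma bump_eq_0:
  assumes "norm x \<ge> e" "e > 0" shows "bump e x = 0" "bump_grad e x = 0"
proof -
  have "e\<^sup>2 \<le> (norm x)\<^sup>2" using assms by (intro power_mono) auto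
  then show "bump e x = 0" "bump_grad e x = 0"
    by (simp_all add: bump_def bump_grad_def dot_square_norm)
qed

lemma continuous_on_bump: "continuous_on S (bump e)"
  unfolding bump_def by (intro continuous_intros)

lemma continuous_on_bump_grad: "continuous_on S (bump_grad e)"
  unfolding bump_grad_def by (intro continuous_intros)

lemma bump_le: "bump e x \<le> e ^ 4"
proof -
  have "(max 0 (e\<^sup>2 - x \<bullet> x))\<^sup>2 \<le> (e\<^sup>2)\<^sup>2" by (intro power_mono) auto
  then show ?thesis by (simp add: bump_def sqpos_def)
qed

lemma bump_grad_le:
  assumes "e > 0" shows "norm (bump_grad e x) \<le> 4 * e ^ 3"
proof (cases "norm x \<ge> e")
  case True
  then show ?thesis using assms by (simp add: bump_eq_0)
next
  case False
  have "norm (bump_grad e x) = 4 * (max 0 (e\<^sup>2 - x \<bullet> x) * norm x)"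
    by (simp add: bump_grad_def)
  also have "\<dots> \<le> 4 * (e\<^sup>2 * e)"
    using False assms by (intro mult_left_mono mult_mono) auto
  finally show ?thesis by (simp add: power2_eq_square power3_eq_cube)
qed

text \<open>The argument of \<open>sqpos\<close> moves from \<open>t\<close> to
  \<open>t + s\<close>, so \<open>sqpos_remainder\<close> applies; the part
  \<open>h \<bullet> h\<close> of \<open>s\<close> leaves the extra term with
  \<open>2 * e\<^sup>2\<close>. Beyond \<open>norm x \<ge> e + 1\<close> everything vanishes, so
  \<open>norm x\<close> is bounded in the other case and the constant is independent of
  \<open>x\<close>.\<close>

lemma bump_remainder:
  fixes x h :: "'a::euclidean_space"
  assumes e: "e > 0" and h: "norm h \<le> 1"
  shows "\<bar>bump e (x + h) - bump e x - h \<bullet> bump_grad e x\<bar> \<le> ((2 * e + 3)\<^sup>2 + 2 * e\<^sup>2) * (norm h)\<^sup>2"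
proof (cases "norm x \<ge> e + 1")
  case True
  moreover from True have "norm (x + h) \<ge> e"
    using h norm_triangle_ineq4[of "x + h" h] by simp
  ultimately show ?thesis using e by (simp add: bump_eq_0)
next
  case False
  define t s where "t = e\<^sup>2 - x \<bullet> x" and "s = - (2 * (x \<bullet> h) + h \<bullet> h)"
  have ts: "e\<^sup>2 - (x + h) \<bullet> (x + h) = t + s"
    by (simp add: t_def s_def inner_add inner_commute algebra_simps)
  have "bump e (x + h) - bump e x - h \<bullet> bump_grad e x =
     (sqpos (t + s) - sqpos t - 2 * max 0 t * s) - 2 * max 0 t * (h \<bullet> h)"
    unfolding bump_def bump_grad_def ts by (simp add: t_def[symmetric] s_def inner_commute algebra_simps)
  also have "\<bar>\<dots>\<bar> \<le> \<bar>sqpos (t + s) - sqpos t - 2 * max 0 t * s\<bar> + \<bar>2 * max 0 t * (h \<bullet> h)\<bar>"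
    by (rule abs_triangle_ineq4)
  also have "\<dots> \<le> s\<^sup>2 + 2 * e\<^sup>2 * (norm h)\<^sup>2"
  proof (rule add_mono[OF sqpos_remainder])
    have "max 0 t \<le> e\<^sup>2" by (simp add: t_def)
    then have "2 * max 0 t * (h \<bullet> h) \<le> 2 * e\<^sup>2 * (h \<bullet> h)"
      by (intro mult_right_mono) auto
    then show "\<bar>2 * max 0 t * (h \<bullet> h)\<bar> \<le> 2 * e\<^sup>2 * (norm h)\<^sup>2"
      by (simp add: dot_square_norm)
  qed
  finally have 1: "\<bar>bump e (x + h) - bump e x - h \<bullet> bump_grad e x\<bar> \<le> s\<^sup>2 + 2 * e\<^sup>2 * (norm h)\<^sup>2" .
  have 2: "s\<^sup>2 \<le> ((2 * e + 3) * norm h)\<^sup>2"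
  proof -
    have "\<bar>s\<bar> \<le> 2 * \<bar>x \<bullet> h\<bar> + h \<bullet> h" unfolding s_def using inner_ge_zero[of h] by linarith
    also have "\<dots> \<le> 2 * (norm x * norm h) + norm h * norm h"
      using Cauchy_Schwarz_ineq2[of x h] by (simp add: dot_square_norm power2_eq_square)
    also have "\<dots> = (2 * norm x + norm h) * norm h" by (simp add: algebra_simps)
    also have "\<dots> \<le> (2 * e + 3) * norm h"
      using False h by (intro mult_right_mono) auto
    finally show ?thesis by (metis abs_ge_zero power2_abs power_mono)
  qed
  have "((2 * e + 3)\<^sup>2 + 2 * e\<^sup>2) * (norm h)\<^sup>2 = ((2 * e + 3) * norm h)\<^sup>2 + 2 * e\<^sup>2 * (norm h)\<^sup>2"
    by (simp add: power2_eq_square algebra_simps)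
  then show ?thesis using 1 2 by linarith
qed

text \<open>The type argument fixes the space, and thereby the dimension, which \<open>e\<close>
  alone does not determine.\<close>

definition bump_mass :: "'a::euclidean_space itself \<Rightarrow> real \<Rightarrow> real" where
  "bump_mass _ e = (LINT x|(lborel :: 'a measure). bump e x)"

lemma continuous_bounded_support_integrable:
  fixes f :: "'a::euclidean_space \<Rightarrow> 'b::euclidean_space"
  assumes "continuous_on UNIV f" and "\<And>x. x \<notin> cball a r \<Longrightarrow> f x = 0"
  shows "integrable lborel f"
proof -
  have "integrable lborel (\<lambda>x. indicator (cball a r) x *\<^sub>R f x)"
    by (intro borel_integrable_compact compact_cball continuous_on_subset[OF assms(1)] subset_UNIV)
  also have "(\<lambda>x. indicator (cball a r) x *\<^sub>R f x) = f"
    using assms(2) by (auto simp: indicator_def fun_eq_iff)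
  finally show ?thesis .
qed

lemma integrable_bump: "e > 0 \<Longrightarrow> integrable lborel (bump e)"
  by (rule continuous_bounded_support_integrable[where a = 0 and r = e])
     (auto intro!: bump_eq_0 continuous_on_bump)

lemma bump_mass_pos:
  assumes e: "e > 0" shows "bump_mass TYPE('a::euclidean_space) e > 0"
proof -
  \<comment> \<open>\<open>?c\<close> is the value of the bump at distance \<open>e / 2\<close> from
    the origin, a lower bound on the half ball.\<close>
  let ?c = "(e\<^sup>2 - (e/2)\<^sup>2)\<^sup>2"
  have "0 < ?c" using e by (simp add: power2_eq_square)
  have "0 < ?c * measure lborel (ball (0::'a) (e/2))"
    using e content_ball_pos[of "e/2" "0::'a"] \<open>0 < ?c\<close> by simp
  also have "\<dots> = (LINT x|(lborel :: 'a measure). ?c * indicator (ball 0 (e/2)) x)"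
    by simp
  also have "\<dots> \<le> (LINT x|(lborel :: 'a measure). bump e x)"
  proof (rule integral_mono)
    show "integrable lborel (\<lambda>x. ?c * indicator (ball (0::'a) (e/2)) x)"
      using emeasure_lborel_ball_finite[of "0::'a" "e/2"] by (intro integrable_mult_right integrable_real_indicator) auto
    show "integrable lborel (bump e :: 'a \<Rightarrow> real)" by (rule integrable_bump[OF e])
    show "?c * indicator (ball 0 (e/2)) x \<le> bump e x" for x :: 'a
    proof (cases "x \<in> ball 0 (e/2)")
      case True
      then have "(norm x)\<^sup>2 \<le> (e/2)\<^sup>2" by (intro power_mono) auto
      moreover have "(e/2)\<^sup>2 \<le> e\<^sup>2" using e by (intro power_mono) auto
      ultimately have "?c \<le> (max 0 (e\<^sup>2 - x \<bullet> x))\<^sup>2" by (intro power_mono) (auto simp: dot_square_norm)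
      then show ?thesis using True by (simp add: bump_def sqpos_def)
    qed simp
  qed
  finally show ?thesis by (simp add: bump_mass_def)
qed

lemma gderiv_quadratic:
  fixes f :: "'a::euclidean_space \<Rightarrow> real"
  assumes "\<And>h. norm h \<le> 1 \<Longrightarrow> \<bar>f (x + h) - f x - h \<bullet> D\<bar> \<le> C * (norm h)\<^sup>2"
  shows "GDERIV f x :> D"
  unfolding gderiv_def has_derivative_at
proof
  show "bounded_linear (\<lambda>h. h \<bullet> D)" by (rule bounded_linear_inner_left)
  show "(\<lambda>h. norm (f (x + h) - f x - h \<bullet> D) / norm h) \<midarrow>0\<rightarrow> 0"
  proof (rule Lim_null_comparison)
    show "\<forall>\<^sub>F h in at 0. norm (norm (f (x + h) - f x - h \<bullet> D) / norm h) \<le> C * norm h"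
      unfolding eventually_at
    proof (intro exI[of _ 1] conjI ballI impI)
      fix h :: 'a assume "h \<noteq> 0 \<and> dist h 0 < 1"
      then show "norm (norm (f (x + h) - f x - h \<bullet> D) / norm h) \<le> C * norm h"
        using assms[of h] by (simp add: divide_le_eq power2_eq_square mult.assoc)
    qed simp
    show "(\<lambda>h. C * norm h) \<midarrow>0\<rightarrow> 0"
      by (rule tendsto_eq_intros refl | simp)+
  qed
qed

lemma C_on_1I:
  fixes f :: "'a::euclidean_space \<Rightarrow> real"
  assumes D: "\<And>x. GDERIV f x :> D x" and "continuous_on UNIV D"
  shows "C_on 1 UNIV f"
proof -
  have d: "(f has_derivative (\<lambda>h. h \<bullet> D x)) (at x)" for x
    using D[of x] by (simp add: gderiv_def)
  have "frechet_derivative f (at x) = (\<lambda>h. h \<bullet> D x)" for x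
    by (rule frechet_derivative_at [symmetric, OF d])
  then show ?thesis
    using d assms(2) by (auto simp: differentiable_def intro!: continuous_intros)
qed

lemma lborel_integral_affine:
  fixes f :: "'a::euclidean_space \<Rightarrow> 'b::{banach, second_countable_topology}"
  assumes "f \<in> borel_measurable borel" "c \<noteq> 0"
  shows "(LINT x|lborel. f x) = \<bar>c\<bar> ^ DIM('a) *\<^sub>R (LINT x|lborel. f (t + c *\<^sub>R x))"
proof -
  have "(LINT x|lborel. f x) = (LINT x|density (distr lborel borel (\<lambda>x. t + c *\<^sub>R x)) (\<lambda>_. \<bar>c\<bar>^DIM('a)). f x)"
    using lborel_affine[OF assms(2), of t] by simp
  also have "\<dots> = (LINT x|distr lborel borel (\<lambda>x. t + c *\<^sub>R x). \<bar>c\<bar>^DIM('a) *\<^sub>R f x)"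
    using assms(1) by (subst integral_density) (auto simp: zero_le_power)
  also have "\<dots> = (LINT x|lborel. \<bar>c\<bar>^DIM('a) *\<^sub>R f (t + c *\<^sub>R x))"
    using assms(1) by (subst integral_distr) auto
  finally show ?thesis by simp
qed

lemma lebesgue_on_integral_eq_lborel:
  fixes f :: "'a::euclidean_space \<Rightarrow> 'b::{banach, second_countable_topology}"
  assumes S: "S \<in> sets lebesgue" and f: "f \<in> borel_measurable borel" and "\<And>x. x \<notin> S \<Longrightarrow> f x = 0"
  shows "(LINT x|lebesgue_on S. f x) = (LINT x|lborel. f x)"
proof -
  have "(LINT x|lebesgue_on S. f x) = (LINT x|lebesgue. indicator S x *\<^sub>R f x)"
    by (rule integral_restrict_space) (use S in auto)
  also have "(\<lambda>x. indicator S x *\<^sub>R f x) = f"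
    using assms(3) by (auto simp: indicator_def fun_eq_iff)
  also have "(LINT x|lebesgue. f x) = (LINT x|lborel. f x)"
    using f by (intro integral_completion) simp
  finally show ?thesis .
qed

definition mollifier :: "real \<Rightarrow> 'a::euclidean_space \<Rightarrow> real" where
  "mollifier e x = bump e x / bump_mass TYPE('a) e"

definition mollifier_grad :: "real \<Rightarrow> 'a::euclidean_space \<Rightarrow> 'a" where
  "mollifier_grad e x = bump_grad e x /\<^sub>R bump_mass TYPE('a) e"

context
  fixes e :: real
  assumes e: "e > 0"
begin

lemma mollifier_nonneg [simp]: "0 \<le> mollifier e (x::'a::euclidean_space)"
  using bump_mass_pos[OF e, where 'a='a] by (simp add: mollifier_def)

lemma mollifier_eq_0:
  assumes "norm x \<ge> e" shows "mollifier e x = 0" "mollifier_grad e x = 0"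
  using bump_eq_0[OF assms e] by (simp_all add: mollifier_def mollifier_grad_def)

lemma continuous_on_mollifier: "continuous_on S (mollifier e :: 'a::euclidean_space \<Rightarrow> real)"
  unfolding mollifier_def using bump_mass_pos[OF e, where 'a='a]
  by (intro continuous_intros continuous_on_bump) auto

lemma continuous_on_mollifier_grad: "continuous_on S (mollifier_grad e :: 'a::euclidean_space \<Rightarrow> 'a)"
  unfolding mollifier_grad_def
  by (intro continuous_intros continuous_on_bump_grad)

lemma mollifier_bounded: "\<exists>B. \<forall>x::'a::euclidean_space. norm (mollifier e x) \<le> B \<and> norm (mollifier_grad e x) \<le> B"
proof -
  let ?m = "bump_mass TYPE('a) e"
  have m: "?m > 0" by (rule bump_mass_pos[OF e])
  have "norm (mollifier e x) \<le> max (e^4 / ?m) (4 * e^3 / ?m)" for x :: 'a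
    using bump_le[of e x] m
    by (simp add: mollifier_def divide_right_mono le_max_iff_disj)
  moreover have "norm (mollifier_grad e x) \<le> max (e^4 / ?m) (4 * e^3 / ?m)" for x :: 'a
  proof -
    have "norm (mollifier_grad e x) = norm (bump_grad e x) / ?m"
      using m by (simp add: mollifier_grad_def divide_inverse)
    also have "\<dots> \<le> 4 * e^3 / ?m"
      using bump_grad_le[OF e, of x] m by (intro divide_right_mono) auto
    finally show ?thesis by simp
  qed
  ultimately show ?thesis by blast
qed

lemma mollifier_remainder:
  "\<exists>C\<ge>0. \<forall>(x::'a::euclidean_space) h. norm h \<le> 1 \<longrightarrow>
     \<bar>mollifier e (x + h) - mollifier e x - h \<bullet> mollifier_grad e x\<bar> \<le> C * (norm h)\<^sup>2"
proof (intro exI conjI allI impI)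
  let ?m = "bump_mass TYPE('a) e"
  let ?C = "((2 * e + 3)\<^sup>2 + 2 * e\<^sup>2) / ?m"
  have m: "?m > 0" by (rule bump_mass_pos[OF e])
  show "0 \<le> ?C" using m by simp
  fix x h :: 'a assume h: "norm h \<le> 1"
  have "mollifier e (x + h) - mollifier e x - h \<bullet> mollifier_grad e x
      = (bump e (x + h) - bump e x - h \<bullet> bump_grad e x) / ?m"
    by (simp add: mollifier_def mollifier_grad_def divide_inverse algebra_simps)
  also have "\<bar>\<dots>\<bar> \<le> ((2 * e + 3)\<^sup>2 + 2 * e\<^sup>2) * (norm h)\<^sup>2 / ?m"
    using bump_remainder[OF e h, of x] m by (simp add: divide_right_mono)
  finally show "\<bar>mollifier e (x + h) - mollifier e x - h \<bullet> mollifier_grad e x\<bar> \<le> ?C * (norm h)\<^sup>2"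
    by simp
qed

lemma mollifier_gderiv: "GDERIV (mollifier e) (x::'a::euclidean_space) :> mollifier_grad e x"
  using mollifier_remainder gderiv_quadratic by metis

lemma integrable_mollifier: "integrable lborel (mollifier e :: 'a::euclidean_space \<Rightarrow> real)"
  unfolding mollifier_def using integrable_bump[OF e, where 'a='a] by simp

lemma integral_mollifier: "(LINT x|lborel. mollifier e (x::'a::euclidean_space)) = 1"
  using bump_mass_pos[OF e, where 'a='a] unfolding mollifier_def by (simp add: bump_mass_def)

lemma integral_mollifier_reflect: "(LINT z|lborel. mollifier e (x - z::'a::euclidean_space)) = 1"
proof -
  have "(LINT z|lborel. mollifier e (z::'a)) = \<bar>-1\<bar> ^ DIM('a) *\<^sub>R (LINT z|lborel. mollifier e (x + (-1) *\<^sub>R z))"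
    by (rule lborel_integral_affine) (auto intro!: borel_measurable_continuous_onI continuous_on_mollifier)
  then show ?thesis by (simp add: integral_mollifier)
qed

lemma integral_mollifier_on:
  assumes S: "S \<in> sets lebesgue" and x: "cball x e \<subseteq> S"
  shows "(LINT z|lebesgue_on S. mollifier e (x - z::'a::euclidean_space)) = 1"
proof -
  have "(LINT z|lebesgue_on S. mollifier e (x - z)) = (LINT z|lborel. mollifier e (x - z))"
  proof (rule lebesgue_on_integral_eq_lborel[OF S])
    show "(\<lambda>z. mollifier e (x - z)) \<in> borel_measurable borel"
      by (intro borel_measurable_continuous_onI continuous_on_compose2[OF continuous_on_mollifier] continuous_intros) auto
    show "mollifier e (x - z) = 0" if "z \<notin> S" for z
    proof (rule mollifier_eq_0)
      show "e \<le> norm (x - z)" using that x by - (rule ccontr, auto simp: subset_iff dist_norm)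
    qed
  qed
  then show ?thesis by (simp add: integral_mollifier_reflect)
qed

text \<open>The kernel is integrated in \<open>x\<close> with \<open>z\<close> fixed, as Tonelli's
  theorem will require. Only an inequality holds: for \<open>z\<close> close to the boundary of
  \<open>S\<close>, part of the mass may lie outside \<open>S\<close>.\<close>

lemma nn_integral_mollifier_le:
  assumes S: "S \<in> sets lebesgue"
  shows "(\<integral>\<^sup>+x. ennreal (mollifier e (x - z::'a::euclidean_space)) \<partial>lebesgue_on S) \<le> 1"
proof -
  have m: "(\<lambda>x. mollifier e (x - z)) \<in> borel_measurable borel"
    by (intro borel_measurable_continuous_onI continuous_on_compose2[OF continuous_on_mollifier] continuous_intros) auto
  have "(\<integral>\<^sup>+x. ennreal (mollifier e (x - z)) \<partial>lebesgue_on S) = (\<integral>\<^sup>+x. ennreal (mollifier e (x - z)) * indicator S x \<partial>lebesgue)"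
    by (rule nn_integral_restrict_space) (use S in auto)
  also have "\<dots> \<le> (\<integral>\<^sup>+x. ennreal (mollifier e (x - z)) \<partial>lebesgue)"
    by (intro nn_integral_mono) (auto simp: indicator_def)
  also have "\<dots> = (\<integral>\<^sup>+x. ennreal (mollifier e (x - z)) \<partial>lborel)"
    by (rule nn_integral_completion)
  also have "\<dots> = (\<integral>\<^sup>+x. ennreal (mollifier e (x::'a)) \<partial>lborel)"
  proof -
    have "(\<integral>\<^sup>+x. ennreal (mollifier e (x::'a)) \<partial>lborel) = (\<integral>\<^sup>+x. ennreal (mollifier e x) \<partial>distr lborel borel ((+) (- z)))"
      by (simp add: lborel_distr_plus)
    also have "\<dots> = (\<integral>\<^sup>+x. ennreal (mollifier e (- z + x)) \<partial>lborel)"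
      by (rule nn_integral_distr) (auto intro!: borel_measurable_continuous_onI continuous_on_mollifier)
    finally show ?thesis by simp
  qed
  also have "\<dots> = 1"
    by (subst nn_integral_eq_integral[OF integrable_mollifier]) (auto simp: integral_mollifier)
  finally show ?thesis .
qed

end

subsection \<open>Convolution on a measurable set\<close>

text \<open>A general bilinear product covers both uses: scalar kernel times vector field and,
  flipped, gradient of the kernel times scalar function. The bounded kernel gives a majorant
  proportional to \<open>norm (f z)\<close>, which also serves dominated convergence in the
  continuity proof.\<close>

lemma convolution_integrable:
  fixes k :: "'a::euclidean_space \<Rightarrow> 'b::euclidean_space" and f :: "'a \<Rightarrow> 'c::euclidean_space"
    and prod :: "'b \<Rightarrow> 'c \<Rightarrow> 'd::euclidean_space"
  assumes "bounded_bilinear prod" and S: "S \<in> sets lebesgue"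
    and k: "continuous_on UNIV k" "\<And>x. norm (k x) \<le> B" and f: "integrable (lebesgue_on S) f"
  shows "integrable (lebesgue_on S) (\<lambda>z. prod (k (x - z)) (f z))"
    and "\<exists>K. \<forall>x z. norm (prod (k (x - z)) (f z)) \<le> K * norm (f z)"
proof -
  interpret bounded_bilinear prod by fact
  obtain K where K: "K \<ge> 0" "\<And>a b. norm (prod a b) \<le> norm a * norm b * K"
    using nonneg_bounded by blast
  have bd: "norm (prod (k (x - z)) (f z)) \<le> B * K * norm (f z)" for x z
  proof -
    have "norm (k (x - z)) * norm (f z) * K \<le> B * norm (f z) * K"
      using K(1) k(2) by (intro mult_right_mono) auto
    then show ?thesis using K(2)[of "k (x - z)" "f z"] by (simp add: ac_simps)
  qed
  then show "\<exists>K. \<forall>x z. norm (prod (k (x - z)) (f z)) \<le> K * norm (f z)" by blast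
  have "integrable (lebesgue_on S) (\<lambda>z. (B * K) *\<^sub>R norm (f z))" using f by simp
  then show "integrable (lebesgue_on S) (\<lambda>z. prod (k (x - z)) (f z))"
  proof (rule Bochner_Integration.integrable_bound)
    show "(\<lambda>z. prod (k (x - z)) (f z)) \<in> borel_measurable (lebesgue_on S)"
    proof (rule borel_measurable_continuous_Pair[where H=prod])
      show "(\<lambda>z. k (x - z)) \<in> borel_measurable (lebesgue_on S)"
        by (intro continuous_imp_measurable_on_sets_lebesgue[OF _ S] continuous_on_compose2[OF k(1)] continuous_intros) auto
      show "f \<in> borel_measurable (lebesgue_on S)" using f by simp
      show "continuous_on UNIV (\<lambda>x. prod (fst x) (snd x))"
        by (intro continuous_on continuous_intros)
    qed
    show "AE z in lebesgue_on S. norm (prod (k (x - z)) (f z)) \<le> norm ((B * K) *\<^sub>R norm (f z))"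
      using order_trans[OF bd abs_ge_self] by auto
  qed
qed

lemma convolution_continuous:
  fixes k :: "'a::euclidean_space \<Rightarrow> 'b::euclidean_space" and f :: "'a \<Rightarrow> 'c::euclidean_space"
    and prod :: "'b \<Rightarrow> 'c \<Rightarrow> 'd::euclidean_space"
  assumes "bounded_bilinear prod" and S: "S \<in> sets lebesgue"
    and k: "continuous_on UNIV k" "\<And>x. norm (k x) \<le> B" and f: "integrable (lebesgue_on S) f"
  shows "continuous_on UNIV (\<lambda>x. LINT z|lebesgue_on S. prod (k (x - z)) (f z))"
  unfolding continuous_on_sequentially
proof (intro allI ballI impI; clarsimp simp: comp_def)
  interpret bounded_bilinear prod by fact
  fix X :: "nat \<Rightarrow> 'a" and x assume X: "X \<longlonglongrightarrow> x"
  obtain K where K: "\<And>x z. norm (prod (k (x - z)) (f z)) \<le> K * norm (f z)"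
    using convolution_integrable(2)[OF assms] by blast
  show "(\<lambda>n. LINT z|lebesgue_on S. prod (k (X n - z)) (f z)) \<longlonglongrightarrow> (LINT z|lebesgue_on S. prod (k (x - z)) (f z))"
  proof (rule integral_dominated_convergence[where w = "\<lambda>z. K * norm (f z)"])
    show "AE z in lebesgue_on S. (\<lambda>n. prod (k (X n - z)) (f z)) \<longlonglongrightarrow> prod (k (x - z)) (f z)"
    proof (intro always_eventually allI tendsto)
      fix z
      have "isCont k (x - z)" using k(1) by (simp add: continuous_on_eq_continuous_at)
      moreover have "(\<lambda>n. X n - z) \<longlonglongrightarrow> x - z" by (intro tendsto_intros X)
      ultimately show "(\<lambda>n. k (X n - z)) \<longlonglongrightarrow> k (x - z)" by (rule isCont_tendsto_compose)
    qed simp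
  qed (use f K convolution_integrable(1)[OF assms] in auto)
qed

text \<open>Integrating over \<open>S\<close> alone amounts to extending \<open>f\<close> by zero,
  so this averages \<open>f\<close> with total weight one only where the kernel's ball stays inside
  \<open>S\<close>.\<close>

definition convolve :: "'a::euclidean_space set \<Rightarrow> ('a \<Rightarrow> real) \<Rightarrow> ('a \<Rightarrow> 'b::euclidean_space) \<Rightarrow> 'a \<Rightarrow> 'b" where
  "convolve S k f x = (LINT z|lebesgue_on S. k (x - z) *\<^sub>R f z)"

lemma convolve_mollifier_integrable:
  fixes f :: "'a::euclidean_space \<Rightarrow> 'b::euclidean_space"
  assumes "S \<in> sets lebesgue" "integrable (lebesgue_on S) f" "e > 0"
  shows "integrable (lebesgue_on S) (\<lambda>z. mollifier e (x - z) *\<^sub>R f z)"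
  using mollifier_bounded[OF assms(3), where 'a='a]
    convolution_integrable(1)[OF bounded_bilinear_scaleR assms(1) continuous_on_mollifier[OF assms(3)] _ assms(2)] by blast

lemma convolve_mollifier_continuous:
  fixes f :: "'a::euclidean_space \<Rightarrow> 'b::euclidean_space"
  assumes "S \<in> sets lebesgue" "integrable (lebesgue_on S) f" "e > 0"
  shows "continuous_on UNIV (convolve S (mollifier e) f)"
  unfolding convolve_def
  using mollifier_bounded[OF assms(3), where 'a='a]
    convolution_continuous[OF bounded_bilinear_scaleR assms(1) continuous_on_mollifier[OF assms(3)] _ assms(2)] by blast

text \<open>The derivative is put on the kernel, so this is the classical gradient of the mollified
  function at every point of the space. It is identified with the mollified weak gradient only where
  \<open>cball x e\<close> lies in \<open>S\<close>.\<close>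

definition mollified_grad :: "'a::euclidean_space set \<Rightarrow> real \<Rightarrow> ('a \<Rightarrow> real) \<Rightarrow> 'a \<Rightarrow> 'a" where
  "mollified_grad S e u x = (LINT z|lebesgue_on S. u z *\<^sub>R mollifier_grad e (x - z))"

lemma
  fixes u :: "'a::euclidean_space \<Rightarrow> real"
  assumes S: "S \<in> sets lebesgue" and u: "integrable (lebesgue_on S) u" and e: "e > 0"
  shows mollified_grad_continuous: "continuous_on UNIV (mollified_grad S e u)"
    and mollified_grad_integrable: "integrable (lebesgue_on S) (\<lambda>z. u z *\<^sub>R mollifier_grad e (x - z))"
proof -
  obtain B where "\<And>x. norm (mollifier_grad e (x::'a)) \<le> B"
    using mollifier_bounded[OF e, where 'a='a] by blast
  then show "continuous_on UNIV (mollified_grad S e u)"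
    "integrable (lebesgue_on S) (\<lambda>z. u z *\<^sub>R mollifier_grad e (x - z))"
    unfolding mollified_grad_def
    using convolution_continuous[OF bounded_bilinear.flip[OF bounded_bilinear_scaleR] S continuous_on_mollifier_grad[OF e] _ u]
      convolution_integrable(1)[OF bounded_bilinear.flip[OF bounded_bilinear_scaleR] S continuous_on_mollifier_grad[OF e] _ u]
    by blast+
qed

text \<open>The quadratic remainder of the kernel is uniform in its argument, so integrating it
  against \<open>\<bar>u z\<bar>\<close> gives a quadratic remainder for the convolution;
  integrability of \<open>u\<close> suffices.\<close>

lemma mollified_gderiv:
  fixes u :: "'a::euclidean_space \<Rightarrow> real"
  assumes S: "S \<in> sets lebesgue" and u: "integrable (lebesgue_on S) u" and e: "e > 0"
  shows "GDERIV (convolve S (mollifier e) u) x :> mollified_grad S e u x"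
proof -
  obtain C where C: "C \<ge> 0" "\<And>(x::'a) h. norm h \<le> 1 \<Longrightarrow>
     \<bar>mollifier e (x + h) - mollifier e x - h \<bullet> mollifier_grad e x\<bar> \<le> C * (norm h)\<^sup>2"
    using mollifier_remainder[OF e, where 'a='a] by blast
  note i = convolve_mollifier_integrable[OF S u e]
  note ig = mollified_grad_integrable[OF S u e]
  show ?thesis
  proof (rule gderiv_quadratic)
    fix h :: 'a assume h: "norm h \<le> 1"
    let ?r = "\<lambda>z. mollifier e (x + h - z) - mollifier e (x - z) - h \<bullet> mollifier_grad e (x - z)"
    have "convolve S (mollifier e) u (x + h) - convolve S (mollifier e) u x - h \<bullet> mollified_grad S e u x
      = (LINT z|lebesgue_on S. mollifier e (x + h - z) *\<^sub>R u z - mollifier e (x - z) *\<^sub>R u z - h \<bullet> (u z *\<^sub>R mollifier_grad e (x - z)))"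
      unfolding convolve_def mollified_grad_def using i ig
      by (simp del: real_scaleR_def inner_scaleR_right)
    also have "\<dots> = (LINT z|lebesgue_on S. ?r z * u z)"
      by (simp add: algebra_simps)
    also have "\<bar>\<dots>\<bar> \<le> (LINT z|lebesgue_on S. C * (norm h)\<^sup>2 * \<bar>u z\<bar>)"
    proof (rule Bochner_Integration.integral_norm_bound_integral[where f="\<lambda>z. ?r z * u z", unfolded real_norm_def])
      have "integrable (lebesgue_on S) (\<lambda>z. mollifier e (x + h - z) *\<^sub>R u z - mollifier e (x - z) *\<^sub>R u z - h \<bullet> (u z *\<^sub>R mollifier_grad e (x - z)))"
        using i ig by (intro Bochner_Integration.integrable_diff integrable_inner_right)
      then show "integrable (lebesgue_on S) (\<lambda>z. ?r z * u z)"
        by (simp add: algebra_simps)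
      show "integrable (lebesgue_on S) (\<lambda>z. C * (norm h)\<^sup>2 * \<bar>u z\<bar>)" using u by simp
      show "\<bar>?r z * u z\<bar> \<le> C * (norm h)\<^sup>2 * \<bar>u z\<bar>" for z
        using C(2)[OF h, of "x - z"] unfolding abs_mult by (intro mult_right_mono) (auto simp: algebra_simps)
    qed
    also have "\<dots> = (C * (LINT z|lebesgue_on S. \<bar>u z\<bar>)) * (norm h)\<^sup>2" by simp
    finally show "\<bar>convolve S (mollifier e) u (x + h) - convolve S (mollifier e) u x - h \<bullet> mollified_grad S e u x\<bar>
      \<le> (C * (LINT z|lebesgue_on S. \<bar>u z\<bar>)) * (norm h)\<^sup>2" .
  qed
qed

lemma mollifier_C1_0:
  fixes x :: "'a::euclidean_space"
  assumes e: "e > 0" and x: "cball x e \<subseteq> S"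
  shows "(\<lambda>z. mollifier e (x - z)) \<in> C1_0 S"
    and "grad (\<lambda>z. mollifier e (x - z)) z = - mollifier_grad e (x - z)"
proof -
  have D: "GDERIV (\<lambda>z. mollifier e (x - z)) z :> - mollifier_grad e (x - z)" for z
  proof -
    have 1: "((\<lambda>z. x - z) has_derivative (\<lambda>h. - h)) (at z)"
      by (auto intro!: derivative_eq_intros)
    have 2: "(mollifier e has_derivative (\<lambda>h. h \<bullet> mollifier_grad e (x - z))) (at (x - z))"
      using mollifier_gderiv[OF e] by (simp add: gderiv_def)
    have "((\<lambda>z. mollifier e (x - z)) has_derivative (\<lambda>h. (- h) \<bullet> mollifier_grad e (x - z))) (at z)"
      using has_derivative_compose[OF 1 2] by simp
    then show ?thesis by (simp add: gderiv_def)
  qed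
  then show "grad (\<lambda>z. mollifier e (x - z)) z = - mollifier_grad e (x - z)" by (rule grad_eq)
  have "C_on 1 UNIV (\<lambda>z. mollifier e (x - z))"
    by (rule C_on_1I[OF D]) (intro continuous_intros continuous_on_compose2[OF continuous_on_mollifier_grad[OF e, of UNIV]], auto)
  moreover have "mollifier e (x - z) = 0" if "z \<notin> cball x e" for z
    using that by (intro mollifier_eq_0[OF e]) (auto simp: dist_norm)
  ultimately show "(\<lambda>z. mollifier e (x - z)) \<in> C1_0 S"
    unfolding C1_0_def using x compact_cball by blast
qed

text \<open>The reflected kernel is a test function for the weak gradient; the minus sign from the
  reflection cancels the one in \<open>weak_gradient\<close>.\<close>

lemma mollified_grad_eq_convolve:
  assumes "e > 0" "cball x e \<subseteq> S" "weak_gradient S u Du"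
  shows "mollified_grad S e u x = convolve S (mollifier e) Du x"
proof -
  have "(LINT z|lebesgue_on S. u z *\<^sub>R - mollifier_grad e (x - z)) = - (LINT z|lebesgue_on S. mollifier e (x - z) *\<^sub>R Du z)"
    using assms(3) mollifier_C1_0[OF assms(1,2)] unfolding weak_gradient_def by fastforce
  then show ?thesis by (simp add: mollified_grad_def convolve_def)
qed

lemma cball_add_subset_open:
  fixes K :: "'a::euclidean_space set"
  assumes "compact K" "K \<subseteq> S" "open S"
  obtains r where "r > 0" "compact {x + y | x y. x \<in> K \<and> y \<in> cball 0 r}" "{x + y | x y. x \<in> K \<and> y \<in> cball 0 r} \<subseteq> S"
proof -
  obtain r where r: "r > 0" "(\<Union>x\<in>K. cball x r) \<subseteq> S"
    using compact_subset_open_imp_cball_epsilon_subset[OF assms(1,3,2)] by blast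
  show ?thesis
  proof
    show "compact {x + y | x y. x \<in> K \<and> y \<in> cball 0 r}" by (intro compact_sums assms(1) compact_cball)
    show "{x + y | x y. x \<in> K \<and> y \<in> cball 0 r} \<subseteq> S" using r(2) by (fastforce simp: dist_norm)
  qed fact
qed

text \<open>The kernel has mass one on \<open>S\<close>, so the difference is an average of
  \<open>g z - g x\<close> over points closer than \<open>e\<close>. It is controlled by uniform
  continuity of \<open>g\<close> on a compact neighbourhood of \<open>K\<close> inside
  \<open>S\<close>.\<close>

lemma convolve_mollifier_uniform:
  fixes g :: "'a::euclidean_space \<Rightarrow> 'b::euclidean_space"
  assumes S: "open S" and g: "continuous_on S g" "integrable (lebesgue_on S) g"
    and K: "compact K" "K \<subseteq> S" and \<tau>: "\<tau> > 0"
  shows "\<exists>d>0. \<forall>e x. 0 < e \<and> e < d \<and> x \<in> K \<longrightarrow> cball x e \<subseteq> S \<and> norm (convolve S (mollifier e) g x - g x) \<le> \<tau>"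
proof -
  have Sm: "S \<in> sets lebesgue" using S by auto
  obtain r where r: "r > 0" and K': "compact {x + y | x y. x \<in> K \<and> y \<in> cball 0 r}" "{x + y | x y. x \<in> K \<and> y \<in> cball 0 r} \<subseteq> S"
    using cball_add_subset_open[OF K S] .
  let ?K' = "{x + y | x y. x \<in> K \<and> y \<in> cball 0 r}"
  have "uniformly_continuous_on ?K' g"
    by (intro compact_uniformly_continuous continuous_on_subset[OF g(1)] K')
  then obtain d where d: "d > 0" "\<And>x x'. x \<in> ?K' \<Longrightarrow> x' \<in> ?K' \<Longrightarrow> dist x' x < d \<Longrightarrow> dist (g x') (g x) < \<tau>"
    unfolding uniformly_continuous_on_def using \<tau> by meson
  show ?thesis
  proof (intro exI[of _ "min r d"] conjI allI impI)
    show "0 < min r d" using r d(1) by simp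
    fix e x assume *: "0 < e \<and> e < min r d \<and> x \<in> K"
    then have e: "e > 0" by simp
    have mem: "z \<in> ?K'" if "dist x z \<le> e" for z
      using * that by (intro CollectI exI[of _ x] exI[of _ "z - x"]) (auto simp: dist_norm norm_minus_commute)
    then show cb: "cball x e \<subseteq> S" using K'(2) by (auto simp: subset_iff)
    \<comment> \<open>A non-integrable function has integral 0 by convention, so the value 1 already
      forces integrability.\<close>
    have im: "integrable (lebesgue_on S) (\<lambda>z. mollifier e (x - z))"
      using integral_mollifier_on[OF e Sm cb] not_integrable_integral_eq by fastforce
    have "convolve S (mollifier e) g x - g x = (LINT z|lebesgue_on S. mollifier e (x - z) *\<^sub>R g z) - (LINT z|lebesgue_on S. mollifier e (x - z)) *\<^sub>R g x"
      by (simp add: convolve_def integral_mollifier_on[OF e Sm cb])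
    also have "\<dots> = (LINT z|lebesgue_on S. mollifier e (x - z) *\<^sub>R g z - mollifier e (x - z) *\<^sub>R g x)"
      using im convolve_mollifier_integrable[OF Sm g(2) e, of x] by simp
    also have "norm \<dots> \<le> (LINT z|lebesgue_on S. mollifier e (x - z) * \<tau>)"
    proof (rule Bochner_Integration.integral_norm_bound_integral)
      show "integrable (lebesgue_on S) (\<lambda>z. mollifier e (x - z) *\<^sub>R g z - mollifier e (x - z) *\<^sub>R g x)"
        using im convolve_mollifier_integrable[OF Sm g(2) e, of x] by simp
      show "integrable (lebesgue_on S) (\<lambda>z. mollifier e (x - z) * \<tau>)" using im by simp
      fix z
      show "norm (mollifier e (x - z) *\<^sub>R g z - mollifier e (x - z) *\<^sub>R g x) \<le> mollifier e (x - z) * \<tau>"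
      proof (cases "dist x z < e")
        case True
        then have "dist (g z) (g x) < \<tau>" using mem[of z] mem[of x] * by (intro d(2)) (auto simp: dist_commute)
        then show ?thesis
          unfolding scaleR_diff_right[symmetric] norm_scaleR using mollifier_nonneg[OF e, of "x - z"]
          by (simp add: dist_norm mult_left_mono)
      next
        case False
        then show ?thesis using mollifier_eq_0[OF e, of "x - z"] by (simp add: dist_norm)
      qed
    qed
    also have "\<dots> = \<tau>" by (simp add: integral_mollifier_on[OF e Sm cb])
    finally show "norm (convolve S (mollifier e) g x - g x) \<le> \<tau>" .
  qed
qed

subsection \<open>Approximation in \<open>L\<^sup>p\<close>\<close>

text \<open>Convexity in tangent form. Integrated against a kernel of mass one, with
  \<open>a\<close> the mean, it yields Jensen's inequality.\<close>

lemma powr_tangent_le: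
  fixes a t p :: real
  assumes "p \<ge> 1" "a \<ge> 0" "t \<ge> 0"
  shows "a powr p + p * a powr (p - 1) * (t - a) \<le> t powr p"
proof (cases "a = 0 \<or> t = 0")
  case True
  then show ?thesis
  proof
    \<comment> \<open>\<open>0 powr x\<close> is 0 for every \<open>x\<close>, including
      \<open>x = 0\<close>, so the left side vanishes even for \<open>p = 1\<close>.\<close>
    assume "a = 0" then show ?thesis by simp
  next
    assume t: "t = 0"
    show ?thesis
    proof (cases "a = 0")
      case False
      then have "a powr (p - 1) * a = a powr p" using assms by (simp add: powr_diff)
      then have "a powr p + p * a powr (p - 1) * (t - a) = (1 - p) * a powr p" using t by (simp add: algebra_simps)
      also have "\<dots> \<le> 0" using assms by (intro mult_nonpos_nonneg) auto
      finally show ?thesis using t by simp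
    qed (use t in simp)
  qed
next
  case False
  then have pos: "a > 0" "t > 0" using assms by auto
  have "((\<lambda>x. x powr p) has_real_derivative p * a powr (p - 1)) (at a within {0<..})"
    using pos by (auto intro!: derivative_eq_intros)
  from convex_on_imp_above_tangent[OF powr_convex[OF assms(1)] _ _ _ this, of t] pos
  show ?thesis by (auto simp: interior_open)
qed

text \<open>Each summand is at most the maximum \<open>m\<close>. This crude bound replaces
  Minkowski's inequality: only smallness of integrals of p-th powers matters, not the
  constant.\<close>

lemma powr_add3_le:
  fixes a b c p :: real
  assumes "a \<ge> 0" "b \<ge> 0" "c \<ge> 0" "p \<ge> 0"
  shows "(a + b + c) powr p \<le> 3 powr p * (a powr p + b powr p + c powr p)"
proof -
  define m where "m = max a (max b c)"
  have "(a + b + c) powr p \<le> (3 * m) powr p"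
    using assms by (intro powr_mono2) (auto simp: m_def)
  also have "\<dots> = 3 powr p * m powr p" using assms by (intro powr_mult)
  also have "m powr p \<le> a powr p + b powr p + c powr p"
    unfolding m_def max_def by (auto intro: add_nonneg_nonneg)
  finally show ?thesis by simp
qed

context
  fixes S :: "'a::euclidean_space set"
  assumes S: "S \<in> lmeasurable"
begin

lemma integrable_bounded_lebesgue_on:
  fixes f :: "'a \<Rightarrow> 'b::euclidean_space"
  assumes "f \<in> borel_measurable (lebesgue_on S)" "\<And>x. x \<in> S \<Longrightarrow> norm (f x) \<le> B"
  shows "integrable (lebesgue_on S) f"
  by (rule finite_measure.integrable_const_bound[OF finite_measure_lebesgue_on[OF S], where B=B]) (use assms in auto)

lemma integrable_const_lebesgue_on [simp]: "integrable (lebesgue_on S) (\<lambda>_. c :: 'b::euclidean_space)"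
  by (rule integrable_bounded_lebesgue_on[where B="norm c"]) auto

lemma Lp_on_integrable_powr:
  fixes f :: "'a \<Rightarrow> 'b::euclidean_space"
  assumes f: "Lp_on p S f" and q: "0 \<le> q" "q \<le> p"
  shows "integrable (lebesgue_on S) (\<lambda>x. norm (f x) powr q)"
proof (rule Bochner_Integration.integrable_bound)
  show "integrable (lebesgue_on S) (\<lambda>x. 1 + norm (f x) powr p)"
    using f by (auto simp: Lp_on_def)
  show "(\<lambda>x. norm (f x) powr q) \<in> borel_measurable (lebesgue_on S)"
    using f by (auto simp: Lp_on_def)
  have "t powr q \<le> 1 + t powr p" if "t \<ge> 0" for t :: real
  proof (cases "t \<le> 1")
    case True
    then have "t powr q \<le> 1" using q that by (intro powr_le1) auto
    then show ?thesis by (simp add: add_increasing2)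
  next
    case False
    then have "t powr q \<le> t powr p" using q by (intro powr_mono) auto
    then show ?thesis by simp
  qed
  then show "AE x in lebesgue_on S. norm (norm (f x) powr q) \<le> norm (1 + norm (f x) powr p)"
    by auto
qed

lemma Lp_on_integrable:
  fixes f :: "'a \<Rightarrow> 'b::euclidean_space"
  assumes f: "Lp_on p S f" and "1 \<le> p"
  shows "integrable (lebesgue_on S) f"
proof -
  have "integrable (lebesgue_on S) (\<lambda>x. norm (f x) powr 1)"
    using assms by (intro Lp_on_integrable_powr) auto
  then have "integrable (lebesgue_on S) (\<lambda>x. norm (f x))"
    by simp
  then show ?thesis
    using f by - (rule integrable_norm_cancel, auto simp: Lp_on_def)
qed

lemma Lp_on_diff:
  fixes f g :: "'a \<Rightarrow> 'b::euclidean_space"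
  assumes f: "Lp_on p S f" and g: "Lp_on p S g" and p: "0 \<le> p"
  shows "Lp_on p S (\<lambda>x. f x - g x)"
  unfolding Lp_on_def
proof (rule conjI[OF _ Bochner_Integration.integrable_bound])
  note [measurable] = f[unfolded Lp_on_def, THEN conjunct1] g[unfolded Lp_on_def, THEN conjunct1]
  show "(\<lambda>x. f x - g x) \<in> borel_measurable (lebesgue_on S)"
    "(\<lambda>x. norm (f x - g x) powr p) \<in> borel_measurable (lebesgue_on S)" by measurable
  \<comment> \<open>The summand \<open>0 powr p\<close> equals 0 and only brings the bound into the
    three-term shape of \<open>powr_add3_le\<close>.\<close>
  show "integrable (lebesgue_on S) (\<lambda>x. 3 powr p * (norm (f x) powr p + norm (g x) powr p + 0 powr p))"
    using f g by (simp add: Lp_on_def)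
  show "AE x in lebesgue_on S. norm (norm (f x - g x) powr p) \<le> norm (3 powr p * (norm (f x) powr p + norm (g x) powr p + 0 powr p))"
  proof (intro always_eventually allI)
    fix x
    have "norm (f x - g x) powr p \<le> (norm (f x) + norm (g x) + 0) powr p"
      using p norm_triangle_ineq4[of "f x" "g x"] by (intro powr_mono2) auto
    also have "\<dots> \<le> 3 powr p * (norm (f x) powr p + norm (g x) powr p + 0 powr p)"
      using p by (intro powr_add3_le) auto
    finally show "norm (norm (f x - g x) powr p) \<le> norm (3 powr p * (norm (f x) powr p + norm (g x) powr p + 0 powr p))"
      by simp
  qed
qed

lemma Lp_on_bounded:
  fixes f :: "'a \<Rightarrow> 'b::euclidean_space"
  assumes f: "f \<in> borel_measurable (lebesgue_on S)" "\<And>x. x \<in> S \<Longrightarrow> norm (f x) \<le> B" and p: "0 \<le> p"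
  shows "Lp_on p S f"
  unfolding Lp_on_def
proof (rule conjI[OF f(1) integrable_bounded_lebesgue_on])
  show "(\<lambda>x. norm (f x) powr p) \<in> borel_measurable (lebesgue_on S)" using f by measurable
  show "norm (norm (f x) powr p) \<le> B powr p" if "x \<in> S" for x
    using f(2)[OF that] p by (auto intro: powr_mono2)
qed

text \<open>Truncation by nearest-point projection is continuous and bounded by \<open>n\<close>.
  Since 0 lies in the ball, it moves \<open>v\<close> by at most \<open>norm v\<close>, which
  supplies the majorant for dominated convergence.\<close>

abbreviation "trunc n v \<equiv> closest_point (cball 0 (real n)) v"

lemma norm_trunc_le: "norm (trunc n (v::'b::euclidean_space)) \<le> real n"
  using closest_point_in_set[of "cball (0::'b) (real n)" v] by auto

lemma norm_diff_trunc_le: "norm (v - trunc n (v::'b::euclidean_space)) \<le> norm v"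
  using closest_point_le[of "cball (0::'b) (real n)" 0 v] by (simp add: dist_norm)

lemma continuous_on_trunc: "continuous_on UNIV (trunc n :: 'b::euclidean_space \<Rightarrow> 'b)"
  by (rule continuous_on_closest_point) auto

text \<open>Truncation makes the function bounded at a small cost in the p-norm. On a set of finite
  measure, almost everywhere convergence of truncated continuous functions is then dominated by the
  constant \<open>2 * real n\<close>.\<close>

lemma Lp_on_continuous_approx:
  fixes f :: "'a \<Rightarrow> 'b::euclidean_space"
  assumes f: "Lp_on p S f" and p: "1 \<le> p" and \<tau>: "\<tau> > 0"
  obtains g :: "'a \<Rightarrow> 'b" and B where "continuous_on UNIV g" "\<And>x. norm (g x) \<le> B"
    "(LINT x|lebesgue_on S. norm (f x - g x) powr p) \<le> \<tau>"
proof -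
  have fm [measurable]: "f \<in> borel_measurable (lebesgue_on S)"
    and fi: "integrable (lebesgue_on S) (\<lambda>x. norm (f x) powr p)" using f by (auto simp: Lp_on_def)
  have tm [measurable]: "(trunc n :: 'b \<Rightarrow> 'b) \<in> borel_measurable borel" for n
    by (intro borel_measurable_continuous_onI continuous_on_trunc)
  define \<sigma> where "\<sigma> = \<tau> / (3 powr p * 3)"
  have \<sigma>: "\<sigma> > 0" using \<tau> by (simp add: \<sigma>_def)
  have "(\<lambda>n. LINT x|lebesgue_on S. norm (f x - trunc n (f x)) powr p) \<longlonglongrightarrow> (LINT x|lebesgue_on S. 0)"
  proof (rule integral_dominated_convergence[OF _ _ fi])
    show "AE x in lebesgue_on S. (\<lambda>n. norm (f x - trunc n (f x)) powr p) \<longlonglongrightarrow> 0"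
    proof (rule AE_I2, rule tendsto_eventually)
      fix x
      obtain N where N: "norm (f x) \<le> real N" using real_arch_simple by blast
      show "\<forall>\<^sub>F n in sequentially. norm (f x - trunc n (f x)) powr p = 0"
        using eventually_ge_at_top[of N]
      proof eventually_elim
        case (elim n)
        then have "f x \<in> cball 0 (real n)" using N by simp
        then show ?case using p by (simp add: closest_point_self)
      qed
    qed
    show "AE x in lebesgue_on S. norm (norm (f x - trunc n (f x)) powr p) \<le> norm (f x) powr p" for n
      using p by (auto intro!: powr_mono2 norm_diff_trunc_le)
  qed auto
  then have "\<forall>\<^sub>F n in sequentially. (LINT x|lebesgue_on S. norm (f x - trunc n (f x)) powr p) < \<sigma>"
    using \<sigma> by (intro order_tendstoD(2)[of _ 0]) auto
  then obtain n where n: "(LINT x|lebesgue_on S. norm (f x - trunc n (f x)) powr p) < \<sigma>"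
    using eventually_happens sequentially_bot by blast
  \<comment> \<open>Unfolding \<open>measurable_on\<close> delivers continuous functions converging
    to \<open>f\<close> off a negligible set, which spares a separate density theorem.\<close>
  have "f measurable_on S" using fm S by (simp add: measurable_on_iff_borel_measurable)
  then obtain N G where N: "negligible N" and G: "\<And>j. continuous_on UNIV (G j)"
    and lim: "\<And>x. x \<notin> N \<Longrightarrow> (\<lambda>j. G j x) \<longlonglongrightarrow> (if x \<in> S then f x else 0)"
    unfolding measurable_on_def by blast
  have Gm [measurable]: "G j \<in> borel_measurable (lebesgue_on S)" for j
    using continuous_imp_measurable_on_sets_lebesgue[OF continuous_on_subset[OF G]] S by auto
  have "(\<lambda>j. LINT x|lebesgue_on S. norm (trunc n (f x) - trunc n (G j x)) powr p) \<longlonglongrightarrow> (LINT x|lebesgue_on S. 0)"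
  proof (rule integral_dominated_convergence)
    show "integrable (lebesgue_on S) (\<lambda>x. (2 * real n) powr p)" by simp
    have "AE x in lebesgue. x \<notin> N" using N by (intro AE_not_in) (simp add: negligible_iff_null_sets)
    then have "AE x in lebesgue_on S. x \<notin> N" using S by (subst AE_restrict_space_iff) auto
    moreover have "AE x in lebesgue_on S. x \<in> S" by (rule AE_I2) simp
    ultimately show "AE x in lebesgue_on S. (\<lambda>j. norm (trunc n (f x) - trunc n (G j x)) powr p) \<longlonglongrightarrow> 0"
    proof eventually_elim
      case (elim x)
      have "(\<lambda>j. trunc n (G j x)) \<longlonglongrightarrow> trunc n (f x)"
        using continuous_on_trunc lim[OF elim(1)] elim(2)
        by (intro isCont_tendsto_compose[of _ "trunc n"]) (auto simp: continuous_on_eq_continuous_at)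
      then have "(\<lambda>j. norm (trunc n (f x) - trunc n (G j x))) \<longlonglongrightarrow> norm (trunc n (f x) - trunc n (f x))"
        by (intro tendsto_intros)
      then have "(\<lambda>j. norm (trunc n (f x) - trunc n (G j x)) powr p) \<longlonglongrightarrow> norm (trunc n (f x) - trunc n (f x)) powr p"
        using p by (intro tendsto_powr') auto
      then show ?case using p by simp
    qed
    show "AE x in lebesgue_on S. norm (norm (trunc n (f x) - trunc n (G j x)) powr p) \<le> (2 * real n) powr p" for j
    proof (intro always_eventually allI)
      fix x
      have "norm (trunc n (f x) - trunc n (G j x)) \<le> 2 * real n"
        using norm_triangle_ineq4[of "trunc n (f x)" "trunc n (G j x)"] norm_trunc_le[of n "f x"] norm_trunc_le[of n "G j x"] by linarith
      then show "norm (norm (trunc n (f x) - trunc n (G j x)) powr p) \<le> (2 * real n) powr p"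
        using p by (auto intro!: powr_mono2)
    qed
  qed auto
  then have "\<forall>\<^sub>F j in sequentially. (LINT x|lebesgue_on S. norm (trunc n (f x) - trunc n (G j x)) powr p) < \<sigma>"
    using \<sigma> by (intro order_tendstoD(2)[of _ 0]) auto
  then obtain j where j: "(LINT x|lebesgue_on S. norm (trunc n (f x) - trunc n (G j x)) powr p) < \<sigma>"
    using eventually_happens sequentially_bot by blast
  show ?thesis
  proof
    show "continuous_on UNIV (\<lambda>x. trunc n (G j x))"
      by (rule continuous_on_compose2[OF continuous_on_trunc G]) auto
    show "norm (trunc n (G j x)) \<le> real n" for x by (rule norm_trunc_le)
    have Lt: "Lp_on p S (\<lambda>x. trunc n (f x))" and Lg: "Lp_on p S (\<lambda>x. trunc n (G j x))"
      using p by (auto intro!: Lp_on_bounded norm_trunc_le)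
    have "(LINT x|lebesgue_on S. norm (f x - trunc n (G j x)) powr p)
      \<le> (LINT x|lebesgue_on S. 3 powr p * (norm (f x - trunc n (f x)) powr p + norm (trunc n (f x) - trunc n (G j x)) powr p + 0 powr p))"
    proof (rule integral_mono)
      show "integrable (lebesgue_on S) (\<lambda>x. norm (f x - trunc n (G j x)) powr p)"
        using Lp_on_diff[OF f Lg] p by (simp add: Lp_on_def)
      show "integrable (lebesgue_on S) (\<lambda>x. 3 powr p * (norm (f x - trunc n (f x)) powr p + norm (trunc n (f x) - trunc n (G j x)) powr p + 0 powr p))"
        using Lp_on_diff[OF f Lt] Lp_on_diff[OF Lt Lg] p by (simp add: Lp_on_def)
      fix x
      have "norm (f x - trunc n (G j x)) powr p \<le> (norm (f x - trunc n (f x)) + norm (trunc n (f x) - trunc n (G j x)) + 0) powr p"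
        using p norm_triangle_ineq[of "f x - trunc n (f x)" "trunc n (f x) - trunc n (G j x)"] by (intro powr_mono2) auto
      also have "\<dots> \<le> 3 powr p * (norm (f x - trunc n (f x)) powr p + norm (trunc n (f x) - trunc n (G j x)) powr p + 0 powr p)"
        using p by (intro powr_add3_le) auto
      finally show "norm (f x - trunc n (G j x)) powr p \<le> 3 powr p * (norm (f x - trunc n (f x)) powr p + norm (trunc n (f x) - trunc n (G j x)) powr p + 0 powr p)" .
    qed
    also have "\<dots> = 3 powr p * ((LINT x|lebesgue_on S. norm (f x - trunc n (f x)) powr p) + (LINT x|lebesgue_on S. norm (trunc n (f x) - trunc n (G j x)) powr p))"
      using Lp_on_diff[OF f Lt] Lp_on_diff[OF Lt Lg] p by (simp add: Lp_on_def)
    also have "\<dots> \<le> 3 powr p * (\<sigma> + \<sigma>)"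
      using n j by (intro mult_left_mono) auto
    also have "\<dots> \<le> \<tau>" using \<tau> by (simp add: \<sigma>_def field_simps)
    finally show "(LINT x|lebesgue_on S. norm (f x - trunc n (G j x)) powr p) \<le> \<tau>" .
  qed
qed

text \<open>Jensen's inequality for the probability density \<open>mollifier e (x - z)\<close>, by
  integrating the tangent line of the p-th power at the mean \<open>a\<close> of
  \<open>norm (f z)\<close>. The inclusion of the ball in \<open>S\<close> ensures mass one.\<close>

lemma convolve_mollifier_powr_le:
  fixes f :: "'a \<Rightarrow> 'b::euclidean_space"
  assumes f: "Lp_on p S f" and p: "1 \<le> p" and e: "e > 0" and x: "cball x e \<subseteq> S"
  shows "norm (convolve S (mollifier e) f x) powr p \<le> convolve S (mollifier e) (\<lambda>z. norm (f z) powr p) x"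
proof -
  have Sm: "S \<in> sets lebesgue" using S by auto
  have fi: "integrable (lebesgue_on S) f" and fpi: "integrable (lebesgue_on S) (\<lambda>z. norm (f z) powr p)"
    using Lp_on_integrable[OF f p] f by (auto simp: Lp_on_def)
  note i1 = convolve_mollifier_integrable[OF Sm integrable_norm[OF fi] e, of x]
  note ip = convolve_mollifier_integrable[OF Sm fpi e, of x]
  have i0: "integrable (lebesgue_on S) (\<lambda>z. mollifier e (x - z))"
    using integral_mollifier_on[OF e Sm x] not_integrable_integral_eq by fastforce
  define a where "a = (LINT z|lebesgue_on S. mollifier e (x - z) *\<^sub>R norm (f z))"
  have a: "a \<ge> 0" unfolding a_def using mollifier_nonneg[OF e, where 'a='a] by (intro integral_nonneg_AE) auto
  have "norm (convolve S (mollifier e) f x) \<le> (LINT z|lebesgue_on S. norm (mollifier e (x - z) *\<^sub>R f z))"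
    unfolding convolve_def by (rule integral_norm_bound)
  also have "\<dots> = a" using mollifier_nonneg[OF e, where 'a='a] by (simp add: a_def)
  finally have "norm (convolve S (mollifier e) f x) powr p \<le> a powr p"
    using p by (intro powr_mono2) auto
  \<comment> \<open>The tangent line at \<open>a\<close> is rewritten as constant plus linear part,
    so that its average against the kernel is visibly \<open>a powr p\<close>.\<close>
  also have "a powr p = 1 * (a powr p - p * a powr (p - 1) * a) + p * a powr (p - 1) * a" by simp
  also have "\<dots> = (LINT z|lebesgue_on S. mollifier e (x - z) * (a powr p - p * a powr (p - 1) * a))
      + (LINT z|lebesgue_on S. p * a powr (p - 1) * (mollifier e (x - z) *\<^sub>R norm (f z)))"
    by (simp only: integral_mult_left_zero integral_mult_right_zero integral_mollifier_on[OF e Sm x] a_def[symmetric])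
  also have "\<dots> = (LINT z|lebesgue_on S. mollifier e (x - z) * (a powr p - p * a powr (p - 1) * a)
      + p * a powr (p - 1) * (mollifier e (x - z) *\<^sub>R norm (f z)))"
    using i0 i1 by (intro Bochner_Integration.integral_add[symmetric]) auto
  also have "\<dots> \<le> (LINT z|lebesgue_on S. mollifier e (x - z) *\<^sub>R (norm (f z) powr p))"
  proof (intro integral_mono ip)
    show "integrable (lebesgue_on S) (\<lambda>z. mollifier e (x - z) * (a powr p - p * a powr (p - 1) * a)
      + p * a powr (p - 1) * (mollifier e (x - z) *\<^sub>R norm (f z)))"
      using i0 i1 by (intro Bochner_Integration.integrable_add) auto
    fix z
    have "mollifier e (x - z) * (a powr p + p * a powr (p - 1) * (norm (f z) - a)) \<le> mollifier e (x - z) * norm (f z) powr p"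
      using p a mollifier_nonneg[OF e] by (intro mult_left_mono powr_tangent_le) auto
    then show "mollifier e (x - z) * (a powr p - p * a powr (p - 1) * a) + p * a powr (p - 1) * (mollifier e (x - z) *\<^sub>R norm (f z))
       \<le> mollifier e (x - z) *\<^sub>R (norm (f z) powr p)"
      by (simp add: algebra_simps)
  qed
  finally show ?thesis by (simp add: convolve_def)
qed

text \<open>Tonelli's theorem moves the \<open>x\<close>-integral onto the kernel, where it
  contributes at most 1. Working with nonnegative integrals gives integrability and the bound at
  once.\<close>

lemma convolve_mollifier_L1:
  fixes h :: "'a \<Rightarrow> real"
  assumes h: "integrable (lebesgue_on S) h" "\<And>x. 0 \<le> h x" and e: "e > 0"
  shows "integrable (lebesgue_on S) (convolve S (mollifier e) h)"
    and "(LINT x|lebesgue_on S. convolve S (mollifier e) h x) \<le> (LINT x|lebesgue_on S. h x)"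
proof -
  have Sm: "S \<in> sets lebesgue" using S by auto
  interpret finite_measure "lebesgue_on S" by (rule finite_measure_lebesgue_on[OF S])
  interpret P: pair_sigma_finite "lebesgue_on S" "lebesgue_on S" ..
  have nn: "0 \<le> convolve S (mollifier e) h x" for x
    unfolding convolve_def using mollifier_nonneg[OF e, where 'a='a] h by (intro integral_nonneg_AE) auto
  have [measurable]: "convolve S (mollifier e) h \<in> borel_measurable (lebesgue_on S)"
    using continuous_imp_measurable_on_sets_lebesgue[OF continuous_on_subset[OF convolve_mollifier_continuous[OF Sm h(1) e]] Sm] by auto
  have [measurable]: "h \<in> borel_measurable (lebesgue_on S)" using h by simp
  have [measurable]: "(mollifier e :: 'a \<Rightarrow> real) \<in> borel_measurable borel"
    by (intro borel_measurable_continuous_onI continuous_on_mollifier[OF e])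
  have [measurable]: "(\<lambda>x. x) \<in> borel_measurable (lebesgue_on S)"
    using id_borel_measurable_lebesgue_on[of S] by (simp add: id_def)
  have "(\<integral>\<^sup>+x. ennreal (convolve S (mollifier e) h x) \<partial>lebesgue_on S)
      = (\<integral>\<^sup>+x. (\<integral>\<^sup>+z. ennreal (mollifier e (x - z) * h z) \<partial>lebesgue_on S) \<partial>lebesgue_on S)"
  proof (intro nn_integral_cong)
    fix x
    show "ennreal (convolve S (mollifier e) h x) = (\<integral>\<^sup>+z. ennreal (mollifier e (x - z) * h z) \<partial>lebesgue_on S)"
      unfolding convolve_def using convolve_mollifier_integrable[OF Sm h(1) e, of x] h(2) mollifier_nonneg[OF e, where 'a='a]
      by (subst nn_integral_eq_integral) auto
  qed
  also have "\<dots> = (\<integral>\<^sup>+z. (\<integral>\<^sup>+x. ennreal (mollifier e (x - z) * h z) \<partial>lebesgue_on S) \<partial>lebesgue_on S)"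
    by (rule P.Fubini'[symmetric]) measurable
  also have "\<dots> = (\<integral>\<^sup>+z. (\<integral>\<^sup>+x. ennreal (mollifier e (x - z)) \<partial>lebesgue_on S) * ennreal (h z) \<partial>lebesgue_on S)"
    using h(2) mollifier_nonneg[OF e, where 'a='a]
    by (intro nn_integral_cong) (simp add: ennreal_mult nn_integral_multc)
  also have "\<dots> \<le> (\<integral>\<^sup>+z. 1 * ennreal (h z) \<partial>lebesgue_on S)"
    using nn_integral_mollifier_le[OF e Sm] by (intro nn_integral_mono mult_right_mono) auto
  also have "\<dots> = ennreal (LINT x|lebesgue_on S. h x)"
    using h by (simp add: nn_integral_eq_integral)
  finally have le: "(\<integral>\<^sup>+x. ennreal (convolve S (mollifier e) h x) \<partial>lebesgue_on S) \<le> ennreal (LINT x|lebesgue_on S. h x)" .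
  show i: "integrable (lebesgue_on S) (convolve S (mollifier e) h)"
    using nn le_less_trans[OF le ennreal_less_top] by (intro integrableI_nonneg) auto
  have "ennreal (LINT x|lebesgue_on S. convolve S (mollifier e) h x) \<le> ennreal (LINT x|lebesgue_on S. h x)"
    using le nn by (subst (asm) nn_integral_eq_integral[OF i]) auto
  then show "(LINT x|lebesgue_on S. convolve S (mollifier e) h x) \<le> (LINT x|lebesgue_on S. h x)"
    using h(2) by (subst (asm) ennreal_le_iff) (auto intro: integral_nonneg_AE)
qed

text \<open>With a continuous \<open>g\<close> near \<open>f\<close> and
  \<open>\<epsilon> = f - g\<close>, the error splits into the mollification error of
  \<open>g\<close>, uniformly small on \<open>K\<close>, the mollification of
  \<open>\<epsilon>\<close>, handled by Jensen and the bound in mean, and \<open>\<epsilon>\<close>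
  itself. Each of the three contributes at most \<open>\<sigma>\<close>.\<close>

lemma convolve_mollifier_Lp:
  fixes f :: "'a \<Rightarrow> 'b::euclidean_space"
  assumes "open S" and K: "compact K" "K \<subseteq> S" and f: "Lp_on p S f" and p: "1 \<le> p" and \<tau>: "\<tau> > 0"
  shows "\<exists>d>0. \<forall>e. 0 < e \<and> e < d \<longrightarrow>
    integrable (lebesgue_on S) (\<lambda>x. indicator K x * norm (convolve S (mollifier e) f x - f x) powr p) \<and>
    (LINT x|lebesgue_on S. indicator K x * norm (convolve S (mollifier e) f x - f x) powr p) \<le> \<tau>"
proof -
  have Sm: "S \<in> sets lebesgue" using S by auto
  interpret finite_measure "lebesgue_on S" by (rule finite_measure_lebesgue_on[OF S])
  define \<sigma> where "\<sigma> = \<tau> / (3 powr p * 3)"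
  have \<sigma>: "\<sigma> > 0" using \<tau> by (simp add: \<sigma>_def)
  obtain g B where g: "continuous_on UNIV g" "\<And>x. norm (g x :: 'b) \<le> B"
    and gf: "(LINT x|lebesgue_on S. norm (f x - g x) powr p) \<le> \<sigma>"
    using Lp_on_continuous_approx[OF f p \<sigma>] by metis
  have gc: "continuous_on S g" using g(1) continuous_on_subset by blast
  have gm: "g \<in> borel_measurable (lebesgue_on S)" by (rule continuous_imp_measurable_on_sets_lebesgue[OF gc Sm])
  have gi: "integrable (lebesgue_on S) g" by (rule integrable_bounded_lebesgue_on[OF gm g(2)])
  have fi: "integrable (lebesgue_on S) f" by (rule Lp_on_integrable[OF f p])
  have Lg: "Lp_on p S g" by (rule Lp_on_bounded[OF gm g(2)]) (use p in auto)
  define \<epsilon> where "\<epsilon> = (\<lambda>x. f x - g x)"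
  have Le: "Lp_on p S \<epsilon>" unfolding \<epsilon>_def using Lp_on_diff[OF f Lg] p by simp
  have ei: "integrable (lebesgue_on S) \<epsilon>" by (rule Lp_on_integrable[OF Le p])
  have epi: "integrable (lebesgue_on S) (\<lambda>x. norm (\<epsilon> x) powr p)" using Le by (simp add: Lp_on_def)
  define M where "M = measure (lebesgue_on S) S"
  have M: "M \<ge> 0" by (simp add: M_def)
  \<comment> \<open>Chosen so that the constant \<open>s powr p\<close> integrates to at most
    \<open>\<sigma>\<close> over \<open>S\<close>; the added 1 covers \<open>M = 0\<close>.\<close>
  define s where "s = (\<sigma> / (M + 1)) powr (1 / p)"
  have s: "s > 0" "s powr p = \<sigma> / (M + 1)" using \<sigma> M p by (auto simp: s_def powr_powr)
  obtain d where d: "d > 0" "\<And>e x. 0 < e \<Longrightarrow> e < d \<Longrightarrow> x \<in> K \<Longrightarrow> cball x e \<subseteq> S \<and> norm (convolve S (mollifier e) g x - g x) \<le> s"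
    using convolve_mollifier_uniform[OF \<open>open S\<close> gc gi K s(1)] by blast
  show ?thesis
  proof (intro exI[of _ d] conjI allI impI d(1))
    fix e assume "0 < e \<and> e < d" then have e: "0 < e" "e < d" by auto
    let ?h = "\<lambda>x. indicator K x * norm (convolve S (mollifier e) f x - f x) powr p"
    let ?b = "\<lambda>x. 3 powr p * (s powr p + convolve S (mollifier e) (\<lambda>z. norm (\<epsilon> z) powr p) x + norm (\<epsilon> x) powr p)"
    have le: "?h x \<le> ?b x" for x
    proof (cases "x \<in> K")
      case True
      then have cb: "cball x e \<subseteq> S" and gs: "norm (convolve S (mollifier e) g x - g x) \<le> s" using d(2) e by auto
      have "convolve S (mollifier e) \<epsilon> x = convolve S (mollifier e) f x - convolve S (mollifier e) g x"
        unfolding convolve_def \<epsilon>_def scaleR_diff_right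
        by (rule Bochner_Integration.integral_diff) (rule convolve_mollifier_integrable[OF Sm _ e(1)], fact)+
      then have "convolve S (mollifier e) f x - f x = (convolve S (mollifier e) g x - g x) + convolve S (mollifier e) \<epsilon> x - \<epsilon> x"
        by (simp add: \<epsilon>_def)
      also have "norm \<dots> \<le> norm (convolve S (mollifier e) g x - g x) + norm (convolve S (mollifier e) \<epsilon> x) + norm (\<epsilon> x)"
        by (rule order_trans[OF norm_triangle_ineq4 add_right_mono[OF norm_triangle_ineq]])
      also have "\<dots> \<le> s + norm (convolve S (mollifier e) \<epsilon> x) + norm (\<epsilon> x)" using gs by simp
      finally have "norm (convolve S (mollifier e) f x - f x) powr p \<le> (s + norm (convolve S (mollifier e) \<epsilon> x) + norm (\<epsilon> x)) powr p"
        using p by (intro powr_mono2) auto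
      also have "\<dots> \<le> 3 powr p * (s powr p + norm (convolve S (mollifier e) \<epsilon> x) powr p + norm (\<epsilon> x) powr p)"
        using s p by (intro powr_add3_le) auto
      also have "\<dots> \<le> ?b x"
        using convolve_mollifier_powr_le[OF Le p e(1) cb] by (intro mult_left_mono add_mono) auto
      finally show ?thesis using True by simp
    next
      case False
      have "0 \<le> convolve S (mollifier e) (\<lambda>z. norm (\<epsilon> z) powr p) x"
        unfolding convolve_def using mollifier_nonneg[OF e(1), where 'a='a] by (intro integral_nonneg_AE) auto
      then show ?thesis using False by simp
    qed
    note L1 = convolve_mollifier_L1[OF epi _ e(1)]
    have bi: "integrable (lebesgue_on S) ?b"
      using L1(1) epi by simp
    have [measurable]: "f \<in> borel_measurable (lebesgue_on S)" using fi by simp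
    have [measurable]: "convolve S (mollifier e) f \<in> borel_measurable (lebesgue_on S)"
      using continuous_imp_measurable_on_sets_lebesgue[OF continuous_on_subset[OF convolve_mollifier_continuous[OF Sm fi e(1)]] Sm] by auto
    have "K \<in> sets lebesgue" using K(1) lmeasurable_compact by blast
    then have [measurable]: "K \<in> sets (lebesgue_on S)" using K(2) Sm by (auto simp: sets_restrict_space_iff)
    show hi: "integrable (lebesgue_on S) ?h"
    proof (rule Bochner_Integration.integrable_bound[OF bi])
      show "?h \<in> borel_measurable (lebesgue_on S)" by measurable
      show "AE x in lebesgue_on S. norm (?h x) \<le> norm (?b x)"
      proof (intro always_eventually allI)
        fix x
        have "norm (?h x) = ?h x" by simp
        also note le[of x]
        also have "?b x \<le> norm (?b x)" by (simp only: real_norm_def abs_ge_self)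
        finally show "norm (?h x) \<le> norm (?b x)" .
      qed
    qed
    have "(LINT x|lebesgue_on S. ?h x) \<le> (LINT x|lebesgue_on S. ?b x)"
      by (intro integral_mono hi bi le)
    also have "\<dots> = 3 powr p * (s powr p * M + (LINT x|lebesgue_on S. convolve S (mollifier e) (\<lambda>z. norm (\<epsilon> z) powr p) x)
      + (LINT x|lebesgue_on S. norm (\<epsilon> x) powr p))"
      using L1(1) epi by (simp add: M_def)
    also have "\<dots> \<le> 3 powr p * (\<sigma> + \<sigma> + \<sigma>)"
    proof (intro mult_left_mono add_mono)
      show "s powr p * M \<le> \<sigma>" using \<sigma> M by (simp add: s field_simps)
      show e2: "(LINT x|lebesgue_on S. norm (\<epsilon> x) powr p) \<le> \<sigma>" using gf by (simp add: \<epsilon>_def)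
      show "(LINT x|lebesgue_on S. convolve S (mollifier e) (\<lambda>z. norm (\<epsilon> z) powr p) x) \<le> \<sigma>"
        using L1(2) e2 by simp
    qed auto
    also have "\<dots> = \<tau>" by (simp add: \<sigma>_def)
    finally show "(LINT x|lebesgue_on S. ?h x) \<le> \<tau>" .
  qed
qed

end

subsection \<open>Test functions and the radial barrier\<close>

lemma gderiv_eq_0_outside:
  fixes f :: "'a::euclidean_space \<Rightarrow> real"
  assumes "GDERIV f x :> D" "open U" "x \<in> U" "\<And>z. z \<in> U \<Longrightarrow> f z = 0"
  shows "D = 0"
proof -
  have "((\<lambda>_. 0) has_derivative (\<lambda>h. h \<bullet> D)) (at x)"
    using has_derivative_transform_within_open[of f "\<lambda>h. h \<bullet> D" x UNIV U "\<lambda>_. 0"] assms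
    by (auto simp: gderiv_def)
  then have "(\<lambda>h. h \<bullet> D) = (\<lambda>h. 0)"
    by (rule has_derivative_unique) simp
  then have "D \<bullet> D = 0" by metis
  then show ?thesis by simp
qed

text \<open>This is the divergence theorem for the field \<open>x - y\<close>, whose divergence is
  the dimension. It comes from differentiating, at \<open>s = 0\<close>, the scaling law by which
  dilation with factor \<open>1 + s\<close> about \<open>y\<close> multiplies the integral by the
  power \<open>- DIM('a)\<close> of \<open>1 + s\<close>.\<close>

lemma integral_gderiv_dilation:
  fixes \<phi> :: "'a::euclidean_space \<Rightarrow> real"
  assumes D: "\<And>x. GDERIV \<phi> x :> D x" and Dc: "continuous_on UNIV D"
    and supp: "\<And>x. x \<notin> cball y r \<Longrightarrow> \<phi> x = 0"
  shows "(LINT x|lborel. D x \<bullet> (x - y)) = - DIM('a) * (LINT x|lborel. \<phi> x)"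
proof -
  have \<phi>c: "continuous_on UNIV \<phi>"
    using D by (intro has_derivative_continuous_on[where f' = "\<lambda>x h. h \<bullet> D x"]) (auto simp: gderiv_def)
  have \<phi>m [measurable]: "\<phi> \<in> borel_measurable borel" using \<phi>c by (rule borel_measurable_continuous_onI)
  have D0: "D x = 0" if "x \<notin> cball y r" for x
    using that supp by (intro gderiv_eq_0_outside[OF D, of "- cball y r"]) auto
  have "compact (D ` cball y r)" by (intro compact_continuous_image continuous_on_subset[OF Dc]) auto
  then obtain L where L: "\<And>x. x \<in> cball y r \<Longrightarrow> norm (D x) \<le> L"
    unfolding bounded_iff by (meson compact_imp_bounded bounded_iff imageI)
  define L' where "L' = max L 0"
  have L': "norm (D x) \<le> L'" "L' \<ge> 0" for x using L[of x] D0[of x] by (cases "x \<in> cball y r"; force simp: L'_def)+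
  have lip: "\<bar>\<phi> a - \<phi> b\<bar> \<le> L' * norm (a - b)" for a b
  proof -
    have "norm (\<phi> a - \<phi> b) \<le> L' * norm (a - b)"
    proof (rule differentiable_bound[of UNIV \<phi> "\<lambda>x h. h \<bullet> D x"])
      show "(\<phi> has_derivative (\<lambda>h. h \<bullet> D x)) (at x within UNIV)" for x
        using D by (simp add: gderiv_def)
      show "onorm (\<lambda>h. h \<bullet> D x) \<le> L'" for x
      proof (rule onorm_bound)
        show "norm (h \<bullet> D x) \<le> L' * norm h" for h
          using Cauchy_Schwarz_ineq2[of h "D x"] mult_left_mono[OF L'(1)[of x] norm_ge_zero[of h]]
          by (simp add: mult.commute)
      qed (rule L')
    qed auto
    then show ?thesis by simp
  qed
  have \<phi>i: "integrable lborel \<phi>" by (rule continuous_bounded_support_integrable[OF \<phi>c supp])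
  define I where "I = (LINT x|lborel. \<phi> x)"
  \<comment> \<open>Dilation parameters run through a sequence, as dominated convergence
    requires.\<close>
  define t :: "nat \<Rightarrow> real" where "t n = 1 / real (Suc n)" for n
  have t: "t n > 0" for n by (simp add: t_def)
  have t0: "t \<longlonglongrightarrow> 0" unfolding t_def using LIMSEQ_inverse_real_of_nat by (simp add: inverse_eq_divide)
  define T where "T n x = x + t n *\<^sub>R (x - y)" for n x
  have T: "T n x = - t n *\<^sub>R y + (1 + t n) *\<^sub>R x" for n x by (simp add: T_def algebra_simps)
  have Tc: "continuous_on UNIV (\<lambda>x. \<phi> (T n x))" for n
    unfolding T_def by (intro continuous_on_compose2[OF \<phi>c] continuous_intros) auto
  \<comment> \<open>A factor above 1 shrinks the support towards \<open>y\<close>, so one ball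
    contains the supports of all dilated functions.\<close>
  have nz: "norm (x - y) \<le> r" if "\<phi> (T n x) \<noteq> 0" for n x
  proof -
    have "dist y (T n x) \<le> r" using that supp by force
    moreover have "y - T n x = - ((1 + t n) *\<^sub>R (x - y))" by (simp add: T_def algebra_simps)
    ultimately have "(1 + t n) * norm (x - y) \<le> r"
      using t[of n] by (simp add: dist_norm norm_minus_cancel)
    moreover have "norm (x - y) \<le> (1 + t n) * norm (x - y)" using t[of n] by (simp add: distrib_right)
    ultimately show ?thesis by linarith
  qed
  have Ti: "integrable lborel (\<lambda>x. \<phi> (T n x))" for n
    by (rule continuous_bounded_support_integrable[OF Tc, of y r]) (use nz in \<open>force simp: dist_norm norm_minus_commute\<close>)
  have scale: "I = (1 + t n) ^ DIM('a) * (LINT x|lborel. \<phi> (T n x))" for n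
    using lborel_integral_affine[OF \<phi>m, of "1 + t n" "- t n *\<^sub>R y"] t[of n] by (simp add: I_def T)
  have lim1: "(\<lambda>n. LINT x|lborel. (\<phi> (T n x) - \<phi> x) / t n) \<longlonglongrightarrow> (LINT x|lborel. D x \<bullet> (x - y))"
  proof (rule integral_dominated_convergence)
    show "integrable lborel (\<lambda>x. (L' * r) * indicator (cball y r) x)"
      using emeasure_lborel_cball_finite[of y r] by (intro integrable_mult_right integrable_real_indicator) auto
    have "(\<lambda>x. D x \<bullet> (x - y)) \<in> borel_measurable borel"
      by (intro borel_measurable_continuous_onI continuous_intros Dc)
    then show "(\<lambda>x. D x \<bullet> (x - y)) \<in> borel_measurable lborel" by simp
    show "(\<lambda>x. (\<phi> (T n x) - \<phi> x) / t n) \<in> borel_measurable lborel" for n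
      using \<phi>i Ti by (intro borel_measurable_integrable) auto
    show "AE x in lborel. (\<lambda>n. (\<phi> (T n x) - \<phi> x) / t n) \<longlonglongrightarrow> D x \<bullet> (x - y)"
    proof (rule AE_I2)
      fix x
      have 1: "((\<lambda>s. x + s *\<^sub>R (x - y)) has_derivative (\<lambda>s. s *\<^sub>R (x - y))) (at 0)"
        by (auto intro!: derivative_eq_intros)
      have 2: "(\<phi> has_derivative (\<lambda>h. h \<bullet> D x)) (at (x + 0 *\<^sub>R (x - y)))"
        using D[of x] by (simp add: gderiv_def)
      have "((\<lambda>s. \<phi> (x + s *\<^sub>R (x - y))) has_derivative (\<lambda>s. s *\<^sub>R (x - y) \<bullet> D x)) (at 0)"
        using has_derivative_compose[OF 1 2] .
      then have "((\<lambda>s. \<phi> (x + s *\<^sub>R (x - y))) has_real_derivative (D x \<bullet> (x - y))) (at 0)"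
        unfolding has_field_derivative_def by (rule has_derivative_eq_rhs) (auto simp: fun_eq_iff inner_commute)
      then have "(\<lambda>s. (\<phi> (x + s *\<^sub>R (x - y)) - \<phi> x) / s) \<midarrow>0\<rightarrow> D x \<bullet> (x - y)"
        by (simp add: DERIV_def)
      moreover have "filterlim t (at 0) sequentially"
        using t0 t by (auto simp: filterlim_at intro!: always_eventually) (metis less_irrefl)
      ultimately show "(\<lambda>n. (\<phi> (T n x) - \<phi> x) / t n) \<longlonglongrightarrow> D x \<bullet> (x - y)"
        unfolding T_def by (rule filterlim_compose)
    qed
    show "AE x in lborel. norm ((\<phi> (T n x) - \<phi> x) / t n) \<le> (L' * r) * indicator (cball y r) x" for n
    proof (rule AE_I2)
      fix x
      show "norm ((\<phi> (T n x) - \<phi> x) / t n) \<le> (L' * r) * indicator (cball y r) x"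
      proof (cases "x \<in> cball y r")
        case True
        have "\<bar>\<phi> (T n x) - \<phi> x\<bar> \<le> L' * norm (T n x - x)" by (rule lip)
        also have "\<dots> = t n * (L' * norm (x - y))" using t[of n] by (simp add: T_def)
        also have "\<dots> \<le> t n * (L' * r)"
          using True t[of n] L'(2) by (intro mult_left_mono) (auto simp: dist_norm norm_minus_commute)
        finally have "norm (\<phi> (T n x) - \<phi> x) / t n \<le> L' * r"
          using t[of n] by (simp add: pos_divide_le_eq mult.commute)
        then show ?thesis using True t[of n] by simp
      next
        case False
        then have "\<phi> (T n x) = 0" using nz[of n x] by (auto simp: dist_norm norm_minus_commute)
        then show ?thesis using False supp by simp
      qed
    qed
  qed
  have eq: "(\<lambda>n. LINT x|lborel. (\<phi> (T n x) - \<phi> x) / t n) = (\<lambda>n. I * ((1 + t n) powr (- real DIM('a)) - 1) / t n)"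
  proof
    fix n
    have "(LINT x|lborel. (\<phi> (T n x) - \<phi> x) / t n) = ((LINT x|lborel. \<phi> (T n x)) - I) / t n"
      using Ti \<phi>i by (simp add: I_def)
    also have "(LINT x|lborel. \<phi> (T n x)) = I * (1 + t n) powr (- real DIM('a))"
      using scale[of n] t[of n] by (simp add: powr_minus powr_realpow field_simps)
    finally show "(LINT x|lborel. (\<phi> (T n x) - \<phi> x) / t n) = I * ((1 + t n) powr (- real DIM('a)) - 1) / t n"
      by (simp add: algebra_simps)
  qed
  have lim2: "(\<lambda>n. I * ((1 + t n) powr (- real DIM('a)) - 1) / t n) \<longlonglongrightarrow> I * (- real DIM('a))"
  proof -
    have "((\<lambda>s. (1 + s) powr (- real DIM('a))) has_real_derivative (- real DIM('a))) (at 0)"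
      by (auto intro!: derivative_eq_intros)
    then have "(\<lambda>s. ((1 + s) powr (- real DIM('a)) - 1) / s) \<midarrow>0\<rightarrow> (- real DIM('a))"
      by (simp add: DERIV_def)
    moreover have "filterlim t (at 0) sequentially"
      using t0 t by (auto simp: filterlim_at intro!: always_eventually) (metis less_irrefl)
    ultimately have "(\<lambda>n. ((1 + t n) powr (- real DIM('a)) - 1) / t n) \<longlonglongrightarrow> (- real DIM('a))"
      by (rule filterlim_compose)
    from tendsto_mult[OF tendsto_const this] show ?thesis by simp
  qed
  have "(LINT x|lborel. D x \<bullet> (x - y)) = I * (- real DIM('a))"
    by (rule LIMSEQ_unique[OF lim1[unfolded eq] lim2])
  then show ?thesis by (simp add: I_def mult.commute)
qed

text \<open>As \<open>w\<close> is negative on the sphere, its positive part vanishes in a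
  neighbourhood of the sphere, so cutting off outside the ball creates no jump in the function or
  its gradient.\<close>

lemma sqpos_cutoff:
  fixes w :: "'a::euclidean_space \<Rightarrow> real" and W :: "'a \<Rightarrow> 'a" and y :: 'a and R :: real
  defines "\<phi> \<equiv> \<lambda>x. if x \<in> ball y R then sqpos (w x) else 0"
    and "\<Phi> \<equiv> \<lambda>x. if x \<in> ball y R then (2 * max 0 (w x)) *\<^sub>R W x else 0"
  assumes W: "\<And>x. GDERIV w x :> W x" and Wc: "continuous_on UNIV W"
    and neg: "\<And>x. x \<in> sphere y R \<Longrightarrow> w x < 0"
  shows "GDERIV \<phi> x :> \<Phi> x" and "continuous_on UNIV \<Phi>"
    and "cball y R \<subseteq> S \<Longrightarrow> \<phi> \<in> C1_0 S"
proof -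
  have wc: "continuous_on UNIV w"
    using W by (intro has_derivative_continuous_on[where f' = "\<lambda>x h. h \<bullet> W x"]) (auto simp: gderiv_def)
  have G: "GDERIV \<phi> x :> \<Phi> x" for x
  proof (cases "x \<in> ball y R")
    case True
    have "GDERIV (\<lambda>x. sqpos (w x)) x :> (2 * max 0 (w x)) *\<^sub>R W x"
      by (rule GDERIV_DERIV_compose[OF W sqpos_has_real_derivative])
    then have "((\<lambda>x. sqpos (w x)) has_derivative (\<lambda>h. h \<bullet> \<Phi> x)) (at x)"
      using True by (simp add: gderiv_def \<Phi>_def)
    then show ?thesis unfolding gderiv_def
      by (rule has_derivative_transform_within_open[OF _ open_ball True]) (simp add: \<phi>_def)
  next
    case False
    \<comment> \<open>An open set on which \<open>\<phi>\<close> vanishes. It contains every point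
      outside the open ball, including the sphere because \<open>w\<close> is negative
      there.\<close>
    let ?U = "- (cball y R \<inter> {z. 0 \<le> w z})"
    have "open ?U"
      by (intro open_Compl closed_Int closed_cball closed_Collect_le continuous_intros wc)
    moreover have "x \<in> ?U" using False neg[of x] by (auto simp: sphere_def)
    moreover have "\<phi> z = 0" if "z \<in> ?U" for z
      using that by (auto simp: \<phi>_def)
    ultimately have "(\<phi> has_derivative (\<lambda>h. 0)) (at x)"
      using has_derivative_transform_within_open[of "\<lambda>_. 0" "\<lambda>_. 0" x UNIV ?U "\<phi>"] by auto
    then show ?thesis using False by (simp add: gderiv_def \<Phi>_def)
  qed
  then show "GDERIV \<phi> x :> \<Phi> x" .
  have "continuous_on (cball y R \<union> - ball y R) (\<lambda>x. if x \<in> ball y R then (2 * max 0 (w x)) *\<^sub>R W x else 0)"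
  proof (rule continuous_on_cases)
    show "\<forall>x. x \<in> cball y R \<and> x \<notin> ball y R \<or> x \<in> - ball y R \<and> x \<in> ball y R \<longrightarrow> (2 * max 0 (w x)) *\<^sub>R W x = 0"
      using neg by (force simp: sphere_def max_def)
  qed (auto intro!: continuous_intros continuous_on_subset[OF wc] continuous_on_subset[OF Wc])
  also have "cball y R \<union> - ball y R = UNIV" by auto
  finally show C: "continuous_on UNIV \<Phi>" unfolding \<Phi>_def .
  show "\<phi> \<in> C1_0 S" if "cball y R \<subseteq> S"
    unfolding C1_0_def
  proof (intro CollectI conjI exI)
    show "C_on 1 UNIV \<phi>" by (rule C_on_1I[OF G C])
    show "\<forall>x. x \<notin> cball y R \<longrightarrow> \<phi> x = 0" by (auto simp: \<phi>_def)
  qed (use that in auto)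
qed

text \<open>For \<open>q < 2\<close> the factor \<open>norm z powr (q - 2)\<close> is unbounded near
  the origin, but \<open>q > 1\<close> still gives derivative 0 there; at the origin itself the
  formula is 0.\<close>

lemma norm_powr_gderiv:
  fixes z :: "'a::euclidean_space"
  assumes q: "q > 1"
  shows "GDERIV (\<lambda>z. norm z powr q) z :> (q * norm z powr (q - 2)) *\<^sub>R z"
proof (cases "z = 0")
  case False
  have "GDERIV (\<lambda>z. norm z powr q) z :> (q * norm z powr (q - 1)) *\<^sub>R sgn z"
    using False by (intro GDERIV_DERIV_compose[of norm] GDERIV_norm has_real_derivative_powr) auto
  moreover have "norm z powr (q - 1) = norm z powr (q - 2) * norm z"
    using False powr_add[of "norm z" "q - 2" 1] by simp
  ultimately have "GDERIV (\<lambda>z. norm z powr q) z :> (q * (norm z powr (q - 2) * norm z)) *\<^sub>R sgn z" by simp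
  also have "(q * (norm z powr (q - 2) * norm z)) *\<^sub>R sgn z = (q * norm z powr (q - 2)) *\<^sub>R z"
    using False by (simp add: sgn_div_norm mult.assoc)
  finally show ?thesis .
next
  case True
  have "((\<lambda>h. norm h powr q / norm h) \<longlongrightarrow> 0) (at (0::'a))"
  proof (rule Lim_transform_eventually)
    have "((\<lambda>h::'a. norm h powr (q - 1)) \<longlongrightarrow> norm (0::'a) powr (q - 1)) (at 0)"
      using q by (intro tendsto_powr' tendsto_norm tendsto_ident_at tendsto_const) auto
    then show "((\<lambda>h::'a. norm h powr (q - 1)) \<longlongrightarrow> 0) (at 0)" by simp
    show "\<forall>\<^sub>F h in at (0::'a). norm h powr (q - 1) = norm h powr q / norm h"
      unfolding eventually_at_filter by (auto simp: powr_diff)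
  qed
  then show ?thesis using True by (simp add: gderiv_def has_derivative_at)
qed

lemma norm_powr_gderiv_continuous:
  assumes q: "q > 1"
  shows "continuous_on UNIV (\<lambda>z::'a::euclidean_space. (q * norm z powr (q - 2)) *\<^sub>R z)"
  unfolding continuous_on_eq_continuous_at[OF open_UNIV]
proof
  fix z :: 'a
  show "isCont (\<lambda>z. (q * norm z powr (q - 2)) *\<^sub>R z) z"
  proof (cases "z = 0")
    case False
    then show ?thesis by (intro continuous_intros) auto
  next
    case True
    have "((\<lambda>z. (q * norm z powr (q - 2)) *\<^sub>R z) \<longlongrightarrow> 0) (at (0::'a))"
    proof (rule tendsto_norm_zero_cancel, rule Lim_transform_eventually)
      have "((\<lambda>h::'a. q * norm h powr (q - 1)) \<longlongrightarrow> q * norm (0::'a) powr (q - 1)) (at 0)"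
        using q by (intro tendsto_mult tendsto_powr' tendsto_norm tendsto_ident_at tendsto_const) auto
      then show "((\<lambda>h::'a. q * norm h powr (q - 1)) \<longlongrightarrow> 0) (at 0)" by simp
      have "norm h powr (q - 1) = norm h powr (q - 2) * norm h" if "h \<noteq> 0" for h :: 'a
        using that powr_add[of "norm h" "q - 2" 1] by simp
      then show "\<forall>\<^sub>F h in at (0::'a). q * norm h powr (q - 1) = norm ((q * norm h powr (q - 2)) *\<^sub>R h)"
        unfolding eventually_at_filter using q by auto
    qed
    then show ?thesis using True by (simp add: isCont_def)
  qed
qed

definition p_flux :: "real \<Rightarrow> 'a::euclidean_space \<Rightarrow> 'a" where
  "p_flux p a = (norm a powr (p - 2)) *\<^sub>R a"

lemma norm_p_flux: "norm (p_flux p a) = norm a powr (p - 1)"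
  using powr_add[of "norm a" "p - 2" 1] by (cases "a = 0") (auto simp: p_flux_def)

text \<open>Cauchy-Schwarz on the mixed terms reduces the claim to scalars:
  \<open>norm a - norm b\<close> and the difference of the powers \<open>p - 1\<close> of the norms
  have the same sign.\<close>

lemma p_flux_monotone:
  assumes p: "p \<ge> 1"
  shows "0 \<le> (p_flux p a - p_flux p b) \<bullet> (a - b)"
proof -
  have self: "p_flux p a \<bullet> a = norm a powr (p - 1) * norm a" for a :: 'a
    using powr_add[of "norm a" "p - 2" 1] by (cases "a = 0") (auto simp: p_flux_def dot_square_norm power2_eq_square)
  have cross: "p_flux p a \<bullet> b \<le> norm a powr (p - 1) * norm b" for a b :: 'a
    using norm_cauchy_schwarz[of "p_flux p a" b] by (simp add: norm_p_flux)
  have "0 \<le> (norm a powr (p - 1) - norm b powr (p - 1)) * (norm a - norm b)"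
  proof (cases "norm a \<le> norm b")
    case True
    then have "norm a powr (p - 1) \<le> norm b powr (p - 1)" using p by (intro powr_mono2) auto
    then show ?thesis using True by (intro mult_nonpos_nonpos) auto
  next
    case False
    then have "norm b powr (p - 1) \<le> norm a powr (p - 1)" using p by (intro powr_mono2) auto
    then show ?thesis using False by (intro mult_nonneg_nonneg) auto
  qed
  also have "\<dots> \<le> (p_flux p a - p_flux p b) \<bullet> (a - b)"
    using cross[of a b] cross[of b a] by (simp add: inner_diff self algebra_simps)
  finally show ?thesis .
qed

text \<open>The exponent \<open>p / (p - 1)\<close> makes the flux of \<open>c * norm z powr q\<close> linear in \<open>z\<close>.\<close>

lemma p_flux_barrier:
  fixes z :: "'a::euclidean_space"
  assumes p: "p > 1" and q: "q = p / (p - 1)" and c: "c > 0"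
  shows "p_flux p (c *\<^sub>R (q * norm z powr (q - 2)) *\<^sub>R z) = ((c * q) powr (p - 1)) *\<^sub>R z"
proof (cases "z = 0")
  case False
  have qpos: "q > 0" using p q by simp
  have r: "norm z powr (q - 2) * norm z = norm z powr (q - 1)"
    using False powr_add[of "norm z" "q - 2" 1] by simp
  have n: "norm (c *\<^sub>R (q * norm z powr (q - 2)) *\<^sub>R z) = c * q * norm z powr (q - 1)"
    using c qpos by (simp add: r[symmetric])
  \<comment> \<open>The total exponent of \<open>norm z\<close> is \<open>q * (p - 1) - p\<close>,
    which the choice of \<open>q\<close> makes zero.\<close>
  have e: "(q - 1) * (p - 2) + (q - 2) = 0" using p by (simp add: q field_simps)
  have "(c * q * norm z powr (q - 1)) powr (p - 2) * (c * q * norm z powr (q - 2))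
      = ((c * q) powr (p - 2) * (c * q)) * (norm z powr ((q - 1) * (p - 2)) * norm z powr (q - 2))"
    using c qpos by (simp add: powr_mult powr_powr)
  also have "\<dots> = (c * q) powr (p - 1)"
    using c qpos False powr_add[of "c * q" "p - 2" 1] unfolding powr_add[of "norm z", symmetric] e by simp
  finally show ?thesis
    unfolding p_flux_def n by (simp add: mult.assoc)
qed (simp add: p_flux_def)

text \<open>Young's inequality with a free weight: small \<open>s\<close> tames the term that is
  merely bounded, at the price of a large factor on the term that can be made small. Comparing
  \<open>b\<close> with \<open>s * d\<close> avoids conjugate exponents.\<close>

lemma powr_young:
  fixes d b s p :: real
  assumes "d \<ge> 0" "b \<ge> 0" "s > 0" "p \<ge> 1"
  shows "d powr (p - 1) * b \<le> s * d powr p + s powr (1 - p) * b powr p"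
proof (cases "b \<le> s * d")
  case True
  have "d powr (p - 1) * b \<le> d powr (p - 1) * (s * d)" using True by (intro mult_left_mono) auto
  also have "\<dots> = s * d powr p"
    using assms powr_add[of d "p - 1" 1] by (cases "d = 0") auto
  finally show ?thesis by (simp add: add_increasing2)
next
  case False
  then have b: "b > 0" using assms by (smt (verit) mult_nonneg_nonneg)
  have "d powr (p - 1) * b \<le> (b / s) powr (p - 1) * b"
    using False assms by (intro mult_right_mono powr_mono2) (auto simp: pos_le_divide_eq mult.commute)
  also have "\<dots> = s powr (1 - p) * (b powr (p - 1) * b)"
    using assms b by (simp add: powr_divide powr_diff field_simps)
  also have "b powr (p - 1) * b = b powr p"
    using b powr_add[of b "p - 1" 1] by simp
  finally show ?thesis using assms by (simp add: add_increasing)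
qed

subsection \<open>Comparison with the barrier\<close>

lemma continuous_on_compact_bounded:
  fixes f :: "'a::topological_space \<Rightarrow> 'b::real_normed_vector"
  assumes "compact K" "continuous_on K f"
  obtains B where "\<And>x. x \<in> K \<Longrightarrow> norm (f x) \<le> B"
  using compact_imp_bounded[OF compact_continuous_image[OF assms(2,1)]] by (auto simp: bounded_iff)

text \<open>The integral of the flux difference of \<open>Du\<close> and \<open>V\<close> against
  \<open>\<Phi>\<close> is estimated twice. The equation for \<open>u\<close> and the identity for
  the barrier bound it above by \<open>- (m / 2) * \<kappa>\<close>; monotonicity bounds it below by
  a mollification error that the choice of constants makes too small.\<close>

lemma nondegeneracy_weak_solution:
  fixes \<Omega> :: "'a::euclidean_space set" and u lam :: "'a \<Rightarrow> real"
  assumes \<Omega>: "open \<Omega>" "bounded \<Omega>"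
    and p: "p \<ge> 2" and Du: "sobolev1 p \<Omega> u Du" and uc: "continuous_on \<Omega> u"
    and weak: "\<And>\<phi>. \<phi> \<in> C1_0 \<Omega> \<Longrightarrow> (LINT x|lebesgue_on \<Omega>. p_flux p (Du x) \<bullet> grad \<phi> x)
       = - (LINT x|lebesgue_on \<Omega>. lam x * indicator {y. u y > 0} x * \<phi> x)"
    and lam: "lam \<in> borel_measurable (lebesgue_on \<Omega>)" "m > 0" "\<And>x. x \<in> \<Omega> \<Longrightarrow> m \<le> lam x \<and> lam x \<le> M"
    and R: "R > 0" "cball y R \<subseteq> \<Omega>" and uy: "u y > 0"
    and q: "q = p / (p - 1)" and c: "c > 0" "(c * q) powr (p - 1) = m / (2 * DIM('a))"
  shows "\<exists>x\<in>sphere y R. u x \<ge> c * R powr q"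
proof (rule ccontr)
  assume "\<not> ?thesis"
  then have lt: "\<And>x. x \<in> sphere y R \<Longrightarrow> u x < c * R powr q" by force
  have \<Omega>m: "\<Omega> \<in> lmeasurable" using \<Omega> by (simp add: bounded_set_imp_lmeasurable)
  have \<Omega>s: "\<Omega> \<in> sets lebesgue" using \<Omega>m by blast
  have p1: "1 \<le> p" "p > 1" "0 \<le> p" using p by auto
  have q1: "q > 1" using p by (simp add: q)
  let ?K = "cball y R"
  have LDu: "Lp_on p \<Omega> Du" and Lu: "Lp_on p \<Omega> u" and wg: "weak_gradient \<Omega> u Du"
    using Du by (auto simp: sobolev1_def)
  have ui: "integrable (lebesgue_on \<Omega>) u" by (rule Lp_on_integrable[OF \<Omega>m Lu p1(1)])
  have Dui: "integrable (lebesgue_on \<Omega>) Du" by (rule Lp_on_integrable[OF \<Omega>m LDu p1(1)])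
  have um [measurable]: "u \<in> borel_measurable (lebesgue_on \<Omega>)" using ui by simp
  have Dum [measurable]: "Du \<in> borel_measurable (lebesgue_on \<Omega>)" using Dui by simp
  have contm: "f \<in> borel_measurable (lebesgue_on \<Omega>)" if "continuous_on UNIV f" for f :: "'a \<Rightarrow> 'b::euclidean_space"
    using continuous_imp_measurable_on_sets_lebesgue[OF continuous_on_subset[OF that] \<Omega>s] by auto
  have pfm: "(\<lambda>x. p_flux p (f x)) \<in> borel_measurable (lebesgue_on \<Omega>)" if [measurable]: "f \<in> borel_measurable (lebesgue_on \<Omega>)" for f :: "'a \<Rightarrow> 'a"
    unfolding p_flux_def by measurable

  \<comment> \<open>The barrier and its linear flux\<close>
  define v where "v = (\<lambda>x. c * norm (x - y) powr q)"
  define V where "V = (\<lambda>x. c *\<^sub>R (q * norm (x - y) powr (q - 2)) *\<^sub>R (x - y))"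
  have Vd: "GDERIV v x :> V x" for x
  proof -
    have 1: "((\<lambda>x. x - y) has_derivative (\<lambda>h. h)) (at x)"
      by (auto intro!: derivative_eq_intros)
    have 2: "((\<lambda>z. norm z powr q) has_derivative (\<lambda>h. h \<bullet> ((q * norm (x - y) powr (q - 2)) *\<^sub>R (x - y)))) (at (x - y))"
      using norm_powr_gderiv[OF q1, of "x - y"] by (simp add: gderiv_def)
    from has_derivative_mult_right[OF has_derivative_compose[OF 1 2], of c]
    show ?thesis by (simp add: gderiv_def v_def V_def mult.assoc)
  qed
  have Vc: "continuous_on UNIV V"
    unfolding V_def by (intro continuous_intros continuous_on_compose2[OF norm_powr_gderiv_continuous[OF q1]]) auto
  have vc: "continuous_on UNIV v"
    using Vd by (intro has_derivative_continuous_on[where f' = "\<lambda>x h. h \<bullet> V x"]) (auto simp: gderiv_def)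
  have v0: "v x \<ge> 0" for x using c by (simp add: v_def)
  have vy: "v y = 0" using q1 by (simp add: v_def)
  have vR: "v x = c * R powr q" if "x \<in> sphere y R" for x
    using that by (simp add: v_def dist_norm norm_minus_commute)
  have flux_V: "p_flux p (V x) = (m / (2 * DIM('a))) *\<^sub>R (x - y)" for x
    unfolding V_def using p_flux_barrier[OF p1(2) q c(1)] c(2) by simp

  \<comment> \<open>\<open>u - v\<close> equals \<open>3 * \<delta>\<close> at \<open>y\<close> and
    exceeds \<open>2 * \<delta>\<close> nearby. After the shift by \<open>\<delta>\<close> and a
    mollification error of at most \<open>\<delta> / 2\<close>, \<open>w\<close> is still at least
    \<open>\<delta> / 2\<close> near \<open>y\<close>. The shift exceeds the error, which keeps
    \<open>w < 0\<close> on the sphere and \<open>u > 0\<close> where \<open>w > 0\<close>.\<close>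
  define \<delta> where "\<delta> = u y / 3"
  have \<delta>: "\<delta> > 0" using uy by (simp add: \<delta>_def)
  have yO: "y \<in> \<Omega>" using R by auto
  have "isCont (\<lambda>x. u x - v x) y"
    using uc vc \<Omega>(1) yO by (intro continuous_intros) (auto simp: continuous_on_eq_continuous_at)
  moreover have "u y - v y > 2 * \<delta>" using \<delta> vy by (simp add: \<delta>_def)
  ultimately have "\<forall>\<^sub>F x in nhds y. u x - v x > 2 * \<delta>"
    by (auto simp: isCont_def eventually_nhds_conv_at dest!: order_tendstoD(1))
  then obtain \<rho>0 where \<rho>0: "\<rho>0 > 0" "\<And>x. dist x y < \<rho>0 \<Longrightarrow> u x - v x > 2 * \<delta>"
    unfolding eventually_nhds_metric by blast
  define \<rho> where "\<rho> = min \<rho>0 R"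
  have \<rho>: "\<rho> > 0" "ball y \<rho> \<subseteq> ball y R" "\<And>x. x \<in> ball y \<rho> \<Longrightarrow> u x - v x > 2 * \<delta>"
    using \<rho>0 R by (auto simp: \<rho>_def dist_commute)
  \<comment> \<open>A lower bound for the integral of the test function, fixed before the
    mollification scale \<open>e\<close>.\<close>
  define \<kappa> where "\<kappa> = (\<delta> / 2)\<^sup>2 * measure lebesgue (ball y \<rho>)"
  have \<kappa>: "\<kappa> > 0" using \<delta> \<rho>(1) content_ball_pos[of \<rho> y] by (simp add: \<kappa>_def)

  \<comment> \<open>Bounds and smallness constants independent of the mollification scale\<close>
  have uK: "continuous_on ?K u" using uc R(2) by (rule continuous_on_subset)
  obtain U0 where U0: "\<And>x. x \<in> ?K \<Longrightarrow> norm (u x) \<le> U0"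
    using continuous_on_compact_bounded[OF compact_cball uK] by blast
  obtain B0 where B0: "\<And>x. x \<in> ?K \<Longrightarrow> norm (V x) \<le> B0"
    using continuous_on_compact_bounded[OF compact_cball continuous_on_subset[OF Vc subset_UNIV]] by blast
  define B where "B = max B0 0"
  have B: "B \<ge> 0" "\<And>x. x \<in> ?K \<Longrightarrow> norm (V x) \<le> B" using B0 by (auto simp: B_def le_max_iff_disj)
  \<comment> \<open>Bounds the factor \<open>2 * max 0 (w x)\<close> of \<open>\<Phi>\<close> on the
    ball for every admissible scale.\<close>
  define C where "C = 2 * max 0 (U0 + \<delta>)"
  have C: "C \<ge> 0" by (simp add: C_def)

  \<comment> \<open>A common majorant of \<open>norm (Du x)\<close> and \<open>norm (V x)\<close> on
    the ball with integrable p-th power.\<close>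
  define d where "d x = norm (Du x) + B" for x
  have d: "d x \<ge> 0" for x using B by (simp add: d_def)
  have "Lp_on p \<Omega> (\<lambda>x. norm (Du x) - (- B))"
  proof (rule Lp_on_diff[OF \<Omega>m _ _ p1(3)])
    show "Lp_on p \<Omega> (\<lambda>x. norm (Du x))" using LDu by (auto simp: Lp_on_def)
    show "Lp_on p \<Omega> (\<lambda>_. - B)" by (rule Lp_on_bounded[OF \<Omega>m, where B="norm B"]) (use p1 in auto)
  qed
  then have dpi: "integrable (lebesgue_on \<Omega>) (\<lambda>x. d x powr p)"
    using B by (simp add: Lp_on_def d_def)
  define J where "J = (LINT x|lebesgue_on \<Omega>. d x powr p)"
  have J: "J \<ge> 0" by (simp add: J_def)
  \<comment> \<open>The error will be at most
    \<open>2 * C * (s * J + s powr (1 - p) * \<tau>)\<close>. The weight \<open>s\<close> makes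
    \<open>s * J \<le> \<eta>\<close>, then \<open>\<tau>\<close> makes the other term equal to
    \<open>\<eta>\<close>; the resulting \<open>4 * C * \<eta>\<close> is below
    \<open>m / 2 * \<kappa>\<close>.\<close>
  define \<eta> where "\<eta> = m / 2 * \<kappa> / (8 * (C + 1))"
  have \<eta>: "\<eta> > 0" using lam(2) \<kappa> C by (simp add: \<eta>_def)
  define s where "s = \<eta> / (J + 1)"
  have s: "s > 0" using \<eta> J by (simp add: s_def)
  define \<tau> where "\<tau> = \<eta> * s powr (p - 1)"
  have \<tau>: "\<tau> > 0" using \<eta> s by (simp add: \<tau>_def)

  \<comment> \<open>Mollification and the test function\<close>
  obtain d1 where d1: "d1 > 0" "\<And>e x. 0 < e \<Longrightarrow> e < d1 \<Longrightarrow> x \<in> ?K \<Longrightarrow> cball x e \<subseteq> \<Omega> \<and> norm (convolve \<Omega> (mollifier e) u x - u x) \<le> \<delta> / 2"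
    using convolve_mollifier_uniform[OF \<Omega>(1) uc ui compact_cball R(2), of "\<delta> / 2"] \<delta> by auto
  obtain d2 where d2: "d2 > 0" "\<And>e. 0 < e \<Longrightarrow> e < d2 \<Longrightarrow>
    integrable (lebesgue_on \<Omega>) (\<lambda>x. indicator ?K x * norm (convolve \<Omega> (mollifier e) Du x - Du x) powr p) \<and>
    (LINT x|lebesgue_on \<Omega>. indicator ?K x * norm (convolve \<Omega> (mollifier e) Du x - Du x) powr p) \<le> \<tau>"
    using convolve_mollifier_Lp[OF \<Omega>m \<Omega>(1) compact_cball R(2) LDu p1(1) \<tau>] by blast
  define e where "e = min d1 d2 / 2"
  have e: "e > 0" "e < d1" "e < d2" using d1(1) d2(1) by (auto simp: e_def)
  let ?ue = "convolve \<Omega> (mollifier e) u" and ?De = "convolve \<Omega> (mollifier e) Du"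
  define w where "w = (\<lambda>x. ?ue x - v x - \<delta>)"
  define W where "W = (\<lambda>x. mollified_grad \<Omega> e u x - V x)"
  define \<phi> where "\<phi> = (\<lambda>x. if x \<in> ball y R then sqpos (w x) else 0)"
  define \<Phi> where "\<Phi> = (\<lambda>x. if x \<in> ball y R then (2 * max 0 (w x)) *\<^sub>R W x else 0)"
  have ue: "\<bar>?ue x - u x\<bar> \<le> \<delta> / 2" "cball x e \<subseteq> \<Omega>" if "x \<in> ?K" for x
    using d1(2)[OF e(1,2) that] by auto
  have Wd: "GDERIV w x :> W x" for x
    unfolding w_def W_def using mollified_gderiv[OF \<Omega>s ui e(1), of x] Vd[of x]
    by (auto simp: gderiv_def intro!: derivative_eq_intros simp: inner_diff_right)
  have Wc: "continuous_on UNIV W"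
    unfolding W_def by (intro continuous_intros mollified_grad_continuous[OF \<Omega>s ui e(1)] Vc)
  have neg: "w x < 0" if "x \<in> sphere y R" for x
  proof -
    have "x \<in> ?K" using that by (auto simp: sphere_def)
    then show ?thesis using ue(1)[of x] lt[OF that] vR[OF that] \<delta> unfolding w_def by linarith
  qed
  note cut = sqpos_cutoff[OF Wd Wc neg, of y R, folded \<phi>_def \<Phi>_def]
  have \<phi>C: "\<phi> \<in> C1_0 \<Omega>" using cut(3) R(2) by blast
  have \<Phi>d: "GDERIV \<phi> x :> \<Phi> x" for x unfolding \<Phi>_def using cut(1)[of x] by blast
  have \<Phi>c: "continuous_on UNIV \<Phi>" using cut(2) by blast
  have grad\<phi>: "grad \<phi> x = \<Phi> x" for x by (rule grad_eq[OF \<Phi>d])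
  have \<phi>c: "continuous_on UNIV \<phi>"
    using \<Phi>d by (intro has_derivative_continuous_on[where f' = "\<lambda>x h. h \<bullet> \<Phi> x"]) (auto simp: gderiv_def)
  have \<phi>0: "\<phi> x = 0" "\<Phi> x = 0" if "x \<notin> ball y R" for x using that by (auto simp: \<phi>_def \<Phi>_def)
  have \<phi>0\<Omega>: "\<phi> x = 0" "\<Phi> x = 0" if "x \<notin> \<Omega>" for x
    using \<phi>0[of x] that R(2) ball_subset_cball[of y R] by blast+
  have \<phi>nn: "\<phi> x \<ge> 0" for x by (simp add: \<phi>_def)
  obtain P0 where P0: "\<And>x. x \<in> ?K \<Longrightarrow> norm (\<Phi> x) \<le> P0"
    using continuous_on_compact_bounded[OF compact_cball continuous_on_subset[OF \<Phi>c subset_UNIV]] by blast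
  obtain P1 where P1: "\<And>x. x \<in> ?K \<Longrightarrow> norm (\<phi> x) \<le> P1"
    using continuous_on_compact_bounded[OF compact_cball continuous_on_subset[OF \<phi>c subset_UNIV]] by blast
  note P = P0 P1
  have \<Phi>b: "norm (\<Phi> x) \<le> max 0 P0" for x using P(1)[of x] \<phi>0(2)[of x] by (cases "x \<in> ball y R") auto
  have \<phi>b: "norm (\<phi> x) \<le> max 0 P1" for x using P(2)[of x] \<phi>0(1)[of x] by (cases "x \<in> ball y R") auto
  have [measurable]: "\<phi> \<in> borel_measurable (lebesgue_on \<Omega>)" "\<Phi> \<in> borel_measurable (lebesgue_on \<Omega>)"
    by (rule contm \<phi>c \<Phi>c)+
  have \<phi>i: "integrable (lebesgue_on \<Omega>) \<phi>"
    by (rule integrable_bounded_lebesgue_on[OF \<Omega>m _ \<phi>b]) measurable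

  \<comment> \<open>The two fluxes integrated against the gradient of the test function\<close>
  have flux_u: "integrable (lebesgue_on \<Omega>) (\<lambda>x. p_flux p (Du x) \<bullet> \<Phi> x)"
  proof (rule Bochner_Integration.integrable_bound)
    show "integrable (lebesgue_on \<Omega>) (\<lambda>x. norm (Du x) powr (p - 1) * max 0 P0)"
      using Lp_on_integrable_powr[OF \<Omega>m LDu, of "p - 1"] p1 by simp
    show "(\<lambda>x. p_flux p (Du x) \<bullet> \<Phi> x) \<in> borel_measurable (lebesgue_on \<Omega>)"
      using pfm[OF Dum] by measurable
    show "AE x in lebesgue_on \<Omega>. norm (p_flux p (Du x) \<bullet> \<Phi> x) \<le> norm (norm (Du x) powr (p - 1) * max 0 P0)"
    proof (rule AE_I2)
      fix x
      have "\<bar>p_flux p (Du x) \<bullet> \<Phi> x\<bar> \<le> norm (p_flux p (Du x)) * norm (\<Phi> x)" by (rule Cauchy_Schwarz_ineq2)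
      also have "\<dots> \<le> norm (Du x) powr (p - 1) * max 0 P0"
        unfolding norm_p_flux by (intro mult_left_mono \<Phi>b) auto
      finally show "norm (p_flux p (Du x) \<bullet> \<Phi> x) \<le> norm (norm (Du x) powr (p - 1) * max 0 P0)" by simp
    qed
  qed
  \<comment> \<open>The flux of \<open>V\<close> is a multiple of \<open>x - y\<close>, so
    \<open>integral_gderiv_dilation\<close> evaluates the integral; the dimension cancels and
    \<open>- (m / 2)\<close> remains.\<close>
  have flux_v: "integrable (lebesgue_on \<Omega>) (\<lambda>x. p_flux p (V x) \<bullet> \<Phi> x)"
    and flux_v_eq: "(LINT x|lebesgue_on \<Omega>. p_flux p (V x) \<bullet> \<Phi> x) = - (m / 2) * (LINT x|lebesgue_on \<Omega>. \<phi> x)"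
  proof -
    have eq: "p_flux p (V x) \<bullet> \<Phi> x = (m / (2 * DIM('a))) * (\<Phi> x \<bullet> (x - y))" for x
      by (simp add: flux_V inner_commute)
    have hc: "continuous_on UNIV (\<lambda>x. \<Phi> x \<bullet> (x - y))" by (intro continuous_intros \<Phi>c)
    have "integrable (lebesgue_on \<Omega>) (\<lambda>x. \<Phi> x \<bullet> (x - y))"
    proof (rule integrable_bounded_lebesgue_on[OF \<Omega>m contm[OF hc]])
      fix x
      show "norm (\<Phi> x \<bullet> (x - y)) \<le> max 0 P0 * R"
      proof (cases "x \<in> ball y R")
        case True
        have "\<bar>\<Phi> x \<bullet> (x - y)\<bar> \<le> norm (\<Phi> x) * norm (x - y)" by (rule Cauchy_Schwarz_ineq2)
        also have "\<dots> \<le> max 0 P0 * R" using True by (intro mult_mono \<Phi>b) (auto simp: dist_norm norm_minus_commute)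
        finally show ?thesis by simp
      qed (use \<phi>0 R in simp)
    qed
    then show "integrable (lebesgue_on \<Omega>) (\<lambda>x. p_flux p (V x) \<bullet> \<Phi> x)" by (simp add: eq)
    have "(LINT x|lebesgue_on \<Omega>. \<Phi> x \<bullet> (x - y)) = (LINT x|lborel. \<Phi> x \<bullet> (x - y))"
      by (rule lebesgue_on_integral_eq_lborel[OF \<Omega>s borel_measurable_continuous_onI[OF hc]])
        (simp add: \<phi>0\<Omega>)
    also have "\<dots> = - DIM('a) * (LINT x|lborel. \<phi> x)"
      by (rule integral_gderiv_dilation[OF \<Phi>d \<Phi>c, of y R]) (use \<phi>0 in auto)
    also have "(LINT x|lborel. \<phi> x) = (LINT x|lebesgue_on \<Omega>. \<phi> x)"
      by (rule lebesgue_on_integral_eq_lborel[OF \<Omega>s borel_measurable_continuous_onI[OF \<phi>c], symmetric])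
        (simp add: \<phi>0\<Omega>)
    finally show "(LINT x|lebesgue_on \<Omega>. p_flux p (V x) \<bullet> \<Phi> x) = - (m / 2) * (LINT x|lebesgue_on \<Omega>. \<phi> x)"
      by (simp add: eq)
  qed

  \<comment> \<open>Wherever the test function is nonzero, \<open>w > 0\<close> and hence
    \<open>u > 0\<close>, so the characteristic function is 1 there.\<close>
  have "(LINT x|lebesgue_on \<Omega>. m * \<phi> x) \<le> (LINT x|lebesgue_on \<Omega>. lam x * indicator {y. u y > 0} x * \<phi> x)"
  proof (rule integral_mono_AE)
    show "integrable (lebesgue_on \<Omega>) (\<lambda>x. m * \<phi> x)" using \<phi>i by simp
    have [measurable]: "lam \<in> borel_measurable (lebesgue_on \<Omega>)" by (rule lam)
    have meq: "(\<lambda>x. lam x * indicator {y. u y > 0} x * \<phi> x) = (\<lambda>x. lam x * (if u x > 0 then 1 else 0) * \<phi> x)"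
      by (auto simp: indicator_def)
    show "integrable (lebesgue_on \<Omega>) (\<lambda>x. lam x * indicator {y. u y > 0} x * \<phi> x)"
    proof (rule integrable_bounded_lebesgue_on[OF \<Omega>m, where B="\<bar>M\<bar> * max 0 P1"])
      show "(\<lambda>x. lam x * indicator {y. u y > 0} x * \<phi> x) \<in> borel_measurable (lebesgue_on \<Omega>)"
        unfolding meq by measurable
      fix x assume "x \<in> \<Omega>"
      then have "\<bar>lam x\<bar> \<le> \<bar>M\<bar>" using lam(2) lam(3)[of x] by auto
      then have "\<bar>lam x\<bar> * \<bar>\<phi> x\<bar> \<le> \<bar>M\<bar> * max 0 P1" using \<phi>b[of x] by (intro mult_mono) auto
      then show "norm (lam x * indicator {y. u y > 0} x * \<phi> x) \<le> \<bar>M\<bar> * max 0 P1"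
        by (auto simp: indicator_def abs_mult)
    qed
    show "AE x in lebesgue_on \<Omega>. m * \<phi> x \<le> lam x * indicator {y. u y > 0} x * \<phi> x"
    proof (rule AE_I2)
      fix x assume "x \<in> space (lebesgue_on \<Omega>)"
      then have x: "x \<in> \<Omega>" by simp
      show "m * \<phi> x \<le> lam x * indicator {y. u y > 0} x * \<phi> x"
      proof (cases "x \<in> ball y R \<and> w x > 0")
        case True
        then have "x \<in> ?K" "w x > 0" by auto
        then have "u x > 0" using ue(1)[of x] v0[of x] \<delta> unfolding w_def by linarith
        then show ?thesis using lam(3)[OF x] \<phi>nn[of x] by (simp add: mult_right_mono)
      next
        case False
        then have "\<phi> x = 0" by (auto simp: \<phi>_def)
        then show ?thesis by simp
      qed
    qed
  qed
  then have u_le: "(LINT x|lebesgue_on \<Omega>. p_flux p (Du x) \<bullet> \<Phi> x) \<le> - m * (LINT x|lebesgue_on \<Omega>. \<phi> x)"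
    using weak[OF \<phi>C] by (simp add: grad\<phi>)
  have \<kappa>_le: "\<kappa> \<le> (LINT x|lebesgue_on \<Omega>. \<phi> x)"
  proof -
    have b\<Omega>: "ball y \<rho> \<subseteq> \<Omega>" using \<rho>(2) R(2) by (meson ball_subset_cball subset_trans)
    have bs: "ball y \<rho> \<in> sets (lebesgue_on \<Omega>)"
      using b\<Omega> \<Omega>s by (auto simp: sets_restrict_space_iff)
    have "\<kappa> = (LINT x|lebesgue_on \<Omega>. (\<delta> / 2)\<^sup>2 * indicator (ball y \<rho>) x)"
      using bs b\<Omega> by (simp add: \<kappa>_def measure_restrict_space Int_absorb2 \<Omega>s)
    also have "\<dots> \<le> (LINT x|lebesgue_on \<Omega>. \<phi> x)"
    proof (rule integral_mono[OF _ \<phi>i])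
      show "integrable (lebesgue_on \<Omega>) (\<lambda>x. (\<delta> / 2)\<^sup>2 * indicator (ball y \<rho>) x)"
        by (intro integrable_mult_right integrable_bounded_lebesgue_on[OF \<Omega>m, where B=1] borel_measurable_indicator bs)
          (auto simp: indicator_def)
      fix x
      show "(\<delta> / 2)\<^sup>2 * indicator (ball y \<rho>) x \<le> \<phi> x"
      proof (cases "x \<in> ball y \<rho>")
        case True
        then have xR: "x \<in> ball y R" using \<rho>(2) by blast
        then have "x \<in> ?K" by auto
        then have "w x \<ge> \<delta> / 2" using ue(1)[of x] \<rho>(3)[OF True] unfolding w_def by linarith
        then have "(\<delta> / 2)\<^sup>2 \<le> (max 0 (w x))\<^sup>2" using \<delta> by (intro power_mono) auto
        then show ?thesis using True xR by (simp add: \<phi>_def sqpos_def)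
      next
        case False then show ?thesis using \<phi>nn by simp
      qed
    qed
    finally show ?thesis .
  qed

  \<comment> \<open>Monotonicity up to the mollification error, and the contradiction\<close>
  let ?E = "\<lambda>x. indicator ?K x * norm (?De x - Du x) powr p"
  let ?low = "\<lambda>x. - (2 * C * (s * d x powr p + s powr (1 - p) * ?E x))"
  have low: "?low x \<le> p_flux p (Du x) \<bullet> \<Phi> x - p_flux p (V x) \<bullet> \<Phi> x" for x
  proof (cases "x \<in> ball y R")
    case False
    then show ?thesis using s C \<phi>0 by (simp add: mult_nonneg_nonneg)
  next
    case True
    then have xK: "x \<in> ?K" by auto
    define F where "F = p_flux p (Du x) - p_flux p (V x)"
    define h where "h = 2 * max 0 (w x)"
    \<comment> \<open>The first summand pairs with the flux difference with a sign, by monotonicity;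
      the second is the mollification error, small in the p-norm.\<close>
    have \<Phi>x: "\<Phi> x = h *\<^sub>R ((Du x - V x) + (?De x - Du x))"
      using True mollified_grad_eq_convolve[OF e(1) ue(2)[OF xK] wg] by (simp add: \<Phi>_def W_def h_def)
    have h: "0 \<le> h" "h \<le> C"
    proof -
      have "w x \<le> U0 + \<delta>"
        using ue(1)[OF xK] U0[OF xK] v0[of x] \<delta> unfolding w_def real_norm_def by linarith
      then show "0 \<le> h" "h \<le> C" by (auto simp: h_def C_def)
    qed
    have "norm F \<le> norm (p_flux p (Du x)) + norm (p_flux p (V x))"
      unfolding F_def by (rule norm_triangle_ineq4)
    also have "\<dots> \<le> d x powr (p - 1) + d x powr (p - 1)"
      unfolding norm_p_flux using p1 B xK by (intro add_mono powr_mono2) (auto simp: d_def add_increasing)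
    finally have F: "norm F \<le> 2 * d x powr (p - 1)" by simp
    have arith: "- a \<le> X \<Longrightarrow> a \<le> 2 * b \<Longrightarrow> b \<le> T \<Longrightarrow> 0 \<le> Y \<Longrightarrow> - (2 * T) \<le> Y + X" for a b T X Y :: real
      by linarith
    have "F \<bullet> (?De x - Du x) \<ge> - (norm F * norm (?De x - Du x))"
      using Cauchy_Schwarz_ineq2[of F "?De x - Du x"] by (simp add: abs_le_iff)
    moreover have "norm F * norm (?De x - Du x) \<le> 2 * (d x powr (p - 1) * norm (?De x - Du x))"
      unfolding mult.assoc[symmetric] using F by (rule mult_right_mono) simp
    moreover have "d x powr (p - 1) * norm (?De x - Du x) \<le> s * d x powr p + s powr (1 - p) * ?E x"
      using powr_young[OF d[of x] norm_ge_zero s p1(1), of "?De x - Du x"] xK by simp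
    moreover have "0 \<le> F \<bullet> (Du x - V x)"
      unfolding F_def by (rule p_flux_monotone[OF p1(1)])
    ultimately have "- (2 * (s * d x powr p + s powr (1 - p) * ?E x)) \<le> F \<bullet> ((Du x - V x) + (?De x - Du x))"
      unfolding inner_add_right by (rule arith)
    then have "h * - (2 * (s * d x powr p + s powr (1 - p) * ?E x)) \<le> F \<bullet> \<Phi> x"
      unfolding \<Phi>x inner_scaleR_right using h(1) by (rule mult_left_mono)
    moreover have "h * (2 * (s * d x powr p + s powr (1 - p) * ?E x)) \<le> C * (2 * (s * d x powr p + s powr (1 - p) * ?E x))"
      using h s by (intro mult_right_mono) auto
    moreover have "h * - (2 * T) \<le> Z \<Longrightarrow> h * (2 * T) \<le> C * (2 * T) \<Longrightarrow> - (2 * C * T) \<le> Z" for T Z :: real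
      by simp
    ultimately have "?low x \<le> F \<bullet> \<Phi> x" by blast
    then show ?thesis by (simp add: F_def inner_diff_left)
  qed
  have Ei: "integrable (lebesgue_on \<Omega>) ?E" and E\<tau>: "(LINT x|lebesgue_on \<Omega>. ?E x) \<le> \<tau>"
    using d2(2)[OF e(1,3)] by auto
  have "- (2 * C * (s * J + s powr (1 - p) * \<tau>)) \<le> - (2 * C * (s * J + s powr (1 - p) * (LINT x|lebesgue_on \<Omega>. ?E x)))"
    using E\<tau> C s by (simp add: mult_left_mono)
  also have "\<dots> = (LINT x|lebesgue_on \<Omega>. ?low x)"
    using Ei dpi by (simp add: J_def)
  also have "\<dots> \<le> (LINT x|lebesgue_on \<Omega>. p_flux p (Du x) \<bullet> \<Phi> x - p_flux p (V x) \<bullet> \<Phi> x)"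
    using Ei dpi flux_u flux_v low by (intro integral_mono) auto
  also have "\<dots> \<le> - (m / 2) * (LINT x|lebesgue_on \<Omega>. \<phi> x)"
    using flux_u flux_v u_le by (simp add: flux_v_eq)
  also have "\<dots> \<le> - (m / 2) * \<kappa>"
    using \<kappa>_le lam(2) by simp
  finally have "m / 2 * \<kappa> \<le> 2 * C * (s * J + s powr (1 - p) * \<tau>)" by simp
  moreover have "s * J \<le> \<eta>" using \<eta> J by (simp add: s_def field_simps)
  moreover have "s powr (1 - p) * \<tau> = \<eta>"
    using s powr_add[of s "1 - p" "p - 1"] by (simp add: \<tau>_def)
  ultimately have "m / 2 * \<kappa> \<le> 2 * C * (\<eta> + \<eta>)"
    using C by (smt (verit) mult_left_mono)
  also have "\<dots> < 8 * (C + 1) * \<eta>" using \<eta> C by (simp add: algebra_simps add_pos_nonneg)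
  also have "8 * (C + 1) * \<eta> = m / 2 * \<kappa>"
    unfolding \<eta>_def times_divide_eq_right by (rule nonzero_mult_div_cancel_left) (use C in simp)
  finally show False by simp
qed

text \<open>The constant \<open>a\<close> enters only through the power
  \<open>1 / (p k - 1)\<close>, which tends to 0, and \<open>p k / (p k - 1)\<close> tends to 1.
  Hence the limiting growth rate is exactly 1, whatever the bounds on \<open>lam0\<close>.\<close>

lemma barrier_constant_tendsto:
  fixes p :: "nat \<Rightarrow> real"
  assumes p: "filterlim p at_top sequentially" and "a > 0" "R > 0"
  shows "(\<lambda>k. (a powr (1 / (p k - 1)) / (p k / (p k - 1))) * R powr (p k / (p k - 1))) \<longlonglongrightarrow> R"
proof -
  have "filterlim (\<lambda>k. p k - 1) at_top sequentially"
    using filterlim_tendsto_add_at_top[OF tendsto_const[of "-1"] p] by simp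
  then have z: "(\<lambda>k. 1 / (p k - 1)) \<longlonglongrightarrow> 0"
    by (intro tendsto_divide_0[OF tendsto_const] filterlim_at_top_imp_at_infinity)
  have "(\<lambda>k. 1 + 1 / (p k - 1)) \<longlonglongrightarrow> 1 + 0" by (intro tendsto_intros z)
  moreover have "\<forall>\<^sub>F k in sequentially. p k > 1" using p by (simp add: filterlim_at_top_dense)
  then have "\<forall>\<^sub>F k in sequentially. 1 + 1 / (p k - 1) = p k / (p k - 1)"
    by eventually_elim (simp add: field_simps)
  ultimately have q: "(\<lambda>k. p k / (p k - 1)) \<longlonglongrightarrow> 1"
    using Lim_transform_eventually by fastforce
  have "(\<lambda>k. (a powr (1 / (p k - 1)) / (p k / (p k - 1))) * R powr (p k / (p k - 1))) \<longlonglongrightarrow> (a powr 0 / 1) * R powr 1"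
    using assms(2,3) by (intro tendsto_intros z q) auto
  then show ?thesis using assms by simp
qed

theorem theorem1p4:
  fixes \<Omega> \<Omega>' :: "(real ^ 'n) set"
    and lam0 g u_inf :: "real ^ 'n \<Rightarrow> real"
    and p :: "nat \<Rightarrow> real"
    and u :: "nat \<Rightarrow> real ^ 'n \<Rightarrow> real"
  assumes "bounded_regular_domain \<Omega>"
    and "lam0 \<in> borel_measurable (lebesgue_on \<Omega>)"
    and "\<exists>m M. 0 < m \<and> (\<forall>x\<in>\<Omega>. m \<le> lam0 x \<and> lam0 x \<le> M)"
    and "\<exists>L. L-lipschitz_on (frontier \<Omega>) g"
    and "\<And>k. 1 < p k"
    and "filterlim p at_top sequentially"
    and "\<And>k. weak_solution (p k) \<Omega> lam0 g (u k)"
    and "\<And>k. real CARD('n) < p k \<Longrightarrow> continuous_on \<Omega> (u k)"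
    and "uniform_limit \<Omega> u u_inf sequentially"
    and "compact (closure \<Omega>')" and "closure \<Omega>' \<subseteq> \<Omega>"
  shows "\<exists>r\<^sub>0>0. \<forall>x\<^sub>0 \<in> frontier {x\<in>\<Omega>. u_inf x > 0} \<inter> \<Omega>'. \<forall>r. 0 < r \<and> r < r\<^sub>0 \<longrightarrow>
    (SUP x\<in>ball x\<^sub>0 r. u_inf x) \<ge> r"
proof -
  have \<Omega>: "open \<Omega>" "bounded \<Omega>" using assms(1) by (auto simp: bounded_regular_domain_def)
  obtain m M where m: "m > 0" "\<And>x. x \<in> \<Omega> \<Longrightarrow> m \<le> lam0 x \<and> lam0 x \<le> M" using assms(3) by blast
  have large: "\<forall>\<^sub>F k in sequentially. p k > K" for K
    using assms(6) by (simp add: filterlim_at_top_dense)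
  \<comment> \<open>Continuity is available once \<open>p k\<close> exceeds the dimension, the
    Morrey range, which holds eventually.\<close>
  have cont: "\<forall>\<^sub>F k in sequentially. continuous_on \<Omega> (u k)"
    using large[of "real CARD('n)"] by eventually_elim (rule assms(8))
  have uic: "continuous_on \<Omega> u_inf"
    by (rule uniform_limit_theorem[OF cont assms(9)]) simp
  obtain r0 where r0: "r0 > 0" "(\<Union>x\<in>closure \<Omega>'. cball x r0) \<subseteq> \<Omega>"
    using compact_subset_open_imp_cball_epsilon_subset[OF assms(10) \<Omega>(1) assms(11)] by blast
  have main: "r \<le> (SUP x\<in>ball x0 r. u_inf x)"
    if x0: "x0 \<in> frontier {x\<in>\<Omega>. u_inf x > 0}" "x0 \<in> \<Omega>'" and r: "0 < r" "r < r0" for x0 r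
  proof -
    have cb: "cball x0 r \<subseteq> \<Omega>"
      using r0(2) r x0(2) closure_subset[of \<Omega>'] by (fastforce simp: subset_iff)
    have "compact (u_inf ` cball x0 r)"
      by (intro compact_continuous_image continuous_on_subset[OF uic cb] compact_cball)
    \<comment> \<open>On the reals, a supremum bounds the values from above only if these are
      bounded.\<close>
    then have bdd: "bdd_above (u_inf ` ball x0 r)"
      by (intro bdd_above_mono[OF bounded_imp_bdd_above[OF compact_imp_bounded] image_mono[OF ball_subset_cball]])
    \<comment> \<open>Working with \<open>R < r\<close> leaves room to replace \<open>x0\<close> by
      a point \<open>y\<close> of positivity closer than \<open>r - R\<close>: the ball of radius
      \<open>R\<close> about \<open>y\<close> stays inside \<open>ball x0 r\<close>. Afterwards
      \<open>R\<close> increases to \<open>r\<close>.\<close>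
    have "R \<le> (SUP x\<in>ball x0 r. u_inf x)" if R: "0 < R" "R < r" for R
    proof -
      have "x0 \<in> closure {x\<in>\<Omega>. u_inf x > 0}" using x0(1) by (simp add: frontier_def)
      then obtain y where y: "y \<in> \<Omega>" "u_inf y > 0" "dist y x0 < r - R"
        using R(2) closure_approachable[of x0 "{x\<in>\<Omega>. u_inf x > 0}"] by (auto dest!: spec[of _ "r - R"])
      have sub: "cball y R \<subseteq> ball x0 r"
      proof
        fix z assume "z \<in> cball y R"
        then show "z \<in> ball x0 r"
          using y(3) dist_triangle[of x0 z y] by (simp add: dist_commute)
      qed
      then have yO: "cball y R \<subseteq> \<Omega>" using cb ball_subset_cball by blast
      define a where "a = m / (2 * DIM(real ^ 'n))"
      have a: "a > 0" using m by (simp add: a_def)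
      \<comment> \<open>The solution of \<open>(c * q) powr (p k - 1) = a\<close> with
        \<open>q = p k / (p k - 1)\<close>.\<close>
      define c where "c k = a powr (1 / (p k - 1)) / (p k / (p k - 1))" for k
      have lim: "(\<lambda>k. c k * R powr (p k / (p k - 1))) \<longlonglongrightarrow> R"
        unfolding c_def by (rule barrier_constant_tendsto[OF assms(6) a R(1)])
      have up: "\<forall>\<^sub>F k in sequentially. u k y > 0"
        using order_tendstoD(1)[OF tendsto_uniform_limitI[OF assms(9) y(1)] y(2)] .
      \<comment> \<open>The point of the sphere where \<open>u k\<close> is large depends on
        \<open>k\<close>. Uniform convergence bounds \<open>u k\<close> there by the supremum plus
        \<open>\<epsilon>\<close>, so no convergence of these points is required.\<close>
      have "R \<le> (SUP x\<in>ball x0 r. u_inf x) + \<epsilon>" if \<epsilon>: "\<epsilon> > 0" for \<epsilon>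
      proof (rule tendsto_upperbound[OF lim])
        show "\<forall>\<^sub>F k in sequentially. c k * R powr (p k / (p k - 1)) \<le> (SUP x\<in>ball x0 r. u_inf x) + \<epsilon>"
          using up cont large[of 2] uniform_limitD[OF assms(9) \<epsilon>]
        proof eventually_elim
          case (elim k)
          obtain Du where Du: "sobolev1 (p k) \<Omega> (u k) Du"
            and weak: "\<And>\<phi>. \<phi> \<in> C1_0 \<Omega> \<Longrightarrow> (LINT x|lebesgue_on \<Omega>. p_flux (p k) (Du x) \<bullet> grad \<phi> x)
              = - (LINT x|lebesgue_on \<Omega>. lam0 x * indicator {y. u k y > 0} x * \<phi> x)"
            using assms(7)[of k] unfolding weak_solution_def p_flux_def by blast
          have ck: "c k > 0" using a elim(3) by (simp add: c_def)
          have "c k * (p k / (p k - 1)) = a powr (1 / (p k - 1))"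
            using elim(3) by (simp add: c_def)
          then have "(c k * (p k / (p k - 1))) powr (p k - 1) = m / (2 * DIM(real ^ 'n))"
            using a elim(3) m(1) by (simp add: powr_powr a_def)
          from nondegeneracy_weak_solution[OF \<Omega> _ Du elim(2) weak assms(2) m R(1) yO elim(1) refl ck this]
          obtain x where x: "x \<in> sphere y R" "c k * R powr (p k / (p k - 1)) \<le> u k x"
            using elim(3) by auto
          have xb: "x \<in> ball x0 r" using x(1) sub by (auto simp: sphere_def)
          then have "x \<in> \<Omega>" using cb by auto
          then have "u k x < u_inf x + \<epsilon>" using elim(4) by (auto simp: dist_real_def abs_less_iff)
          moreover have "u_inf x \<le> (SUP x\<in>ball x0 r. u_inf x)" by (rule cSUP_upper[OF xb bdd])
          ultimately show ?case using x(2) by linarith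
        qed
      qed simp
      then show ?thesis by (rule field_le_epsilon)
    qed
    then show ?thesis using dense_le_bounded[OF r(1)] by blast
  qed
  then show ?thesis using r0(1) by blast
qed

end
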